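(* Let $Y$ be a (real or complex) Banach space of dimension at least two, let $(\Omega,\Sigma,\mu)$ be any $\sigma$-finite measure space with $\dim L_1(\mu)\ge 2$, and let $m\in\mathbb N$, $m\ge 2$. The following are equivalent: (i) the pair $(\ell_1^m,Y)$ has the BPBp-RSE; (ii) the pair $(\ell_1,Y)$ has the BPBp-RSE; (iii) the pair $(L_1(\mu),Y)$ has the BPBp-RSE; (iv) $Y$ is uniformly convex.
   Context: Banach spaces are over $\mathbb K\in\{\mathbb R,\mathbb C\}$, with all spaces over the same field; $B_X$, $S_X$ are the closed unit ball and unit sphere of $X$; $\mathbb T=\{\lambda\in\mathbb K:|\lambda|=1\}$; $\mathcal L(X,Y)$ is the space of bounded linear operators. An operator $T\in\mathcal L(X,Y)$ is range strongly exposing, $T\in\mathrm{RSE}(X,Y)$, if there is $x_0\in S_X$ such that whenever $(x_n)\subseteq B_X$ satisfies $\|Tx_n\|\to\|T\|$, there are a subsequence $(x_{\sigma(n)})$ and $\lambda\in\mathbb T$ with $Tx_{\sigma(n)}\to\lambda Tx_0$. The pair $(X,Y)$ has the BPBp-RSE if for every $\varepsilon>0$ there is $0<\eta(\varepsilon)<\varepsilon$ such that for every $T\in\mathcal L(X,Y)$ with $\|T\|=1$ and every $x\in S_X$ with $\|Tx\|>1-\eta(\varepsilon)$, there exist $S\in\mathrm{RSE}(X,Y)$ and $x_0\in S_X$ with $\|S\|=\|Sx_0\|=1$, $\|S-T\|<\varepsilon$ and $\|x-x_0\|<\varepsilon$. $Y$ is uniformly convex if for every $\varepsilon>0$ there is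 $0<\delta<1$ such that $y_1,y_2\in S_Y$ and $\|y_1+y_2\|/2>1-\delta$ imply $\|y_1-y_2\|<\varepsilon$. *)

theory Defs
  imports "HOL-Analysis.Analysis"
begin

text \<open>The scalar field: a normed field that is isometrically isomorphic to the reals or to the
  complex numbers. The types \<open>real\<close> and \<open>complex\<close> are instances.\<close>

class real_or_complex = real_normed_field + banach + second_countable_topology +
  assumes real_or_complex:
    "(\<exists>f :: 'a \<Rightarrow> real. bij f \<and> (\<forall>x y. f (x + y) = f x + f y) \<and> (\<forall>x y. f (x * y) = f x * f y) \<and>
        (\<forall>r x. f (r *\<^sub>R x) = r *\<^sub>R f x) \<and> (\<forall>x. norm (f x) = norm x)) \<or>
     (\<exists>f :: 'a \<Rightarrow> complex. bij f \<and> (\<forall>x y. f (x + y) = f x + f y) \<and> (\<forall>x y. f (x * y) = f x * f y) \<and>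
        (\<forall>r x. f (r *\<^sub>R x) = r *\<^sub>R f x) \<and> (\<forall>x. norm (f x) = norm x))"

instance real :: real_or_complex
  by standard (rule disjI1, rule exI[of _ "\<lambda>x. x"], auto simp: bij_def inj_on_def)

instance complex :: real_or_complex
  by standard (rule disjI2, rule exI[of _ "\<lambda>x. x"], auto simp: bij_def inj_on_def)

text \<open>A Banach space over \<open>'k\<close> is a type of class \<open>banach\<close> (which supplies addition, norm and
  completeness) with a scalar multiplication by \<open>'k\<close> extending the real one. For \<open>'k = real\<close> the
  last assumption forces \<open>smul = scaleR\<close>.\<close>

locale banach_over = vector_space smul
  for smul :: "'k::real_or_complex \<Rightarrow> 'y::banach \<Rightarrow> 'y" +
  assumes norm_smul: "norm (smul c y) = norm c * norm y"
    and smul_of_real: "smul (of_real r) y = r *\<^sub>R y"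

text \<open>Domain spaces depend on parameters (\<open>m\<close>, the measure), so they are given by a carrier
  with explicit operations rather than by a type.\<close>

record ('k, 'x) nspace =
  points :: "'x set"
  zero :: 'x
  add :: "'x \<Rightarrow> 'x \<Rightarrow> 'x"
  smult :: "'k \<Rightarrow> 'x \<Rightarrow> 'x"
  nrm :: "'x \<Rightarrow> real"

definition unit_ball :: "('k, 'x) nspace \<Rightarrow> 'x set" where
  "unit_ball X = {x \<in> points X. nrm X x \<le> 1}"

definition unit_sphere :: "('k, 'x) nspace \<Rightarrow> 'x set" where
  "unit_sphere X = {x \<in> points X. nrm X x = 1}"

definition minus_in :: "('k::ring_1, 'x) nspace \<Rightarrow> 'x \<Rightarrow> 'x \<Rightarrow> 'x" where
  "minus_in X x y = add X x (smult X (- 1) y)"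

definition dim_at_least_2 :: "('k::zero, 'x) nspace \<Rightarrow> bool" where
  "dim_at_least_2 X \<longleftrightarrow> (\<exists>u\<in>points X. \<exists>v\<in>points X.
     \<forall>a b. add X (smult X a u) (smult X b v) = zero X \<longrightarrow> a = 0 \<and> b = 0)"

definition ell1 :: "('k::real_or_complex, nat \<Rightarrow> 'k) nspace" where
  "ell1 = \<lparr> points = {x. summable (\<lambda>i. norm (x i))},
            zero = (\<lambda>i. 0),
            add = (\<lambda>x y i. x i + y i),
            smult = (\<lambda>c x i. c * x i),
            nrm = (\<lambda>x. \<Sum>i. norm (x i)) \<rparr>"

text \<open>Vectors with \<open>m\<close> coordinates are sequences vanishing from index \<open>m\<close> on.\<close>

definition ell1_fin :: "nat \<Rightarrow> ('k::real_or_complex, nat \<Rightarrow> 'k) nspace" where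
  "ell1_fin m = \<lparr> points = {x. \<forall>i\<ge>m. x i = 0},
            zero = (\<lambda>i. 0),
            add = (\<lambda>x y i. x i + y i),
            smult = (\<lambda>c x i. c * x i),
            nrm = (\<lambda>x. \<Sum>i<m. norm (x i)) \<rparr>"

definition L1_class :: "'a measure \<Rightarrow> ('a \<Rightarrow> 'k::real_or_complex) \<Rightarrow> ('a \<Rightarrow> 'k) set" where
  "L1_class M f = {g. integrable M g \<and> (AE w in M. g w = f w)}"

text \<open>The points are the almost-everywhere equivalence classes of integrable functions.
  The operations do not depend on the chosen representatives; see the lemmas below.\<close>

definition L1 :: "'a measure \<Rightarrow> ('k::real_or_complex, ('a \<Rightarrow> 'k) set) nspace" where
  "L1 M = \<lparr> points = L1_class M ` {f. integrable M f},
            zero = L1_class M (\<lambda>w. 0),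
            add = (\<lambda>F G. L1_class M (\<lambda>w. (SOME f. f \<in> F) w + (SOME g. g \<in> G) w)),
            smult = (\<lambda>c F. L1_class M (\<lambda>w. c * (SOME f. f \<in> F) w)),
            nrm = (\<lambda>F. LINT w|M. norm ((SOME f. f \<in> F) w)) \<rparr>"

lemma L1_class_some:
  assumes "integrable M f"
  shows "integrable M (SOME g. g \<in> L1_class M f)" "AE w in M. (SOME g. g \<in> L1_class M f) w = f w"
proof -
  have "f \<in> L1_class M f" using assms by (simp add: L1_class_def)
  then have "(SOME g. g \<in> L1_class M f) \<in> L1_class M f" by (rule someI[where P="\<lambda>g. g \<in> L1_class M f"])
  then show "integrable M (SOME g. g \<in> L1_class M f)"
    "AE w in M. (SOME g. g \<in> L1_class M f) w = f w"
    unfolding L1_class_def by blast+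
qed

lemma L1_class_cong:
  assumes "AE w in M. f w = g w"
  shows "L1_class M f = L1_class M g"
proof -
  have "(AE w in M. h w = f w) \<longleftrightarrow> (AE w in M. h w = g w)" for h
  proof
    show "AE w in M. h w = g w" if "AE w in M. h w = f w"
      using that assms by eventually_elim simp
    show "AE w in M. h w = f w" if "AE w in M. h w = g w"
      using that assms by eventually_elim simp
  qed
  then show ?thesis by (simp add: L1_class_def)
qed

lemma add_L1_class:
  assumes "integrable M f" "integrable M g"
  shows "add (L1 M) (L1_class M f) (L1_class M g) = L1_class M (\<lambda>w. f w + g w)"
proof -
  have "AE w in M. (SOME h. h \<in> L1_class M f) w + (SOME h. h \<in> L1_class M g) w = f w + g w"
    using L1_class_some(2)[OF assms(1)] L1_class_some(2)[OF assms(2)] by eventually_elim simp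
  then show ?thesis unfolding L1_def by (simp, intro L1_class_cong)
qed

lemma smult_L1_class:
  assumes "integrable M f"
  shows "smult (L1 M) c (L1_class M f) = L1_class M (\<lambda>w. c * f w)"
proof -
  have "AE w in M. c * (SOME h. h \<in> L1_class M f) w = c * f w"
    using L1_class_some(2)[OF assms] by eventually_elim simp
  then show ?thesis unfolding L1_def by (simp, intro L1_class_cong)
qed

lemma nrm_L1_class:
  assumes "integrable M f"
  shows "nrm (L1 M) (L1_class M f) = (LINT w|M. norm (f w))"
proof -
  have "AE w in M. norm ((SOME h. h \<in> L1_class M f) w) = norm (f w)"
    using L1_class_some(2)[OF assms] by eventually_elim simp
  then show ?thesis
    unfolding L1_def using assms L1_class_some(1)[OF assms]
    by (simp, intro integral_cong_AE) auto
qed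

text \<open>Operators out of a carrier are functions of which only the values on the carrier
  matter.\<close>

definition bounded_ops ::
    "('k, 'x) nspace \<Rightarrow> ('k \<Rightarrow> 'y \<Rightarrow> 'y) \<Rightarrow> ('x \<Rightarrow> 'y::real_normed_vector) set" where
  "bounded_ops X smul = {T.
     (\<forall>x\<in>points X. \<forall>y\<in>points X. T (add X x y) = T x + T y) \<and>
     (\<forall>c. \<forall>x\<in>points X. T (smult X c x) = smul c (T x)) \<and>
     (\<exists>K. \<forall>x\<in>points X. norm (T x) \<le> K * nrm X x)}"

definition op_norm :: "('k, 'x) nspace \<Rightarrow> ('x \<Rightarrow> 'y::real_normed_vector) \<Rightarrow> real" where
  "op_norm X T = (SUP x\<in>unit_ball X. norm (T x))"

definition RSE ::
    "('k::real_or_complex, 'x) nspace \<Rightarrow> ('k \<Rightarrow> 'y \<Rightarrow> 'y) \<Rightarrow> ('x \<Rightarrow> 'y::real_normed_vector) set" where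
  "RSE X smul = {T \<in> bounded_ops X smul. \<exists>x0\<in>unit_sphere X. \<forall>x :: nat \<Rightarrow> 'x.
     (\<forall>n. x n \<in> unit_ball X) \<and> (\<lambda>n. norm (T (x n))) \<longlonglongrightarrow> op_norm X T \<longrightarrow>
     (\<exists>(\<sigma> :: nat \<Rightarrow> nat) \<theta>. strict_mono \<sigma> \<and> norm \<theta> = 1 \<and>
        (\<lambda>n. T (x (\<sigma> n))) \<longlonglongrightarrow> smul \<theta> (T x0))}"

definition BPBp_RSE ::
    "('k::real_or_complex, 'x) nspace \<Rightarrow> ('k \<Rightarrow> 'y::real_normed_vector \<Rightarrow> 'y) \<Rightarrow> bool" where
  "BPBp_RSE X smul \<longleftrightarrow> (\<forall>\<epsilon>>0. \<exists>\<eta>. 0 < \<eta> \<and> \<eta> < \<epsilon> \<and>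
     (\<forall>T\<in>bounded_ops X smul. op_norm X T = 1 \<longrightarrow>
       (\<forall>x\<in>unit_sphere X. norm (T x) > 1 - \<eta> \<longrightarrow>
         (\<exists>S\<in>RSE X smul. \<exists>x0\<in>unit_sphere X.
            op_norm X S = 1 \<and> norm (S x0) = 1 \<and>
            op_norm X (\<lambda>z. S z - T z) < \<epsilon> \<and> nrm X (minus_in X x x0) < \<epsilon>))))"

definition uniformly_convex :: "'y::real_normed_vector itself \<Rightarrow> bool" where
  "uniformly_convex _ \<longleftrightarrow> (\<forall>\<epsilon>>0. \<exists>\<delta>. 0 < \<delta> \<and> \<delta> < 1 \<and>
     (\<forall>y1 y2 :: 'y. norm y1 = 1 \<and> norm y2 = 1 \<and> norm (y1 + y2) / 2 > 1 - \<delta> \<longrightarrow>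
        norm (y1 - y2) < \<epsilon>))"

end

theory Submission
  imports Defs
begin

text \<open>
  Each of the three domains is a space \<open>X\<close> of integrable functions for some measure \<open>M\<close> (the
  counting measure in the case of sequences). For every such \<open>X\<close> that contains two nonzero functions
  with disjoint supports, the property is equivalent to uniform convexity of the target \<open>Y\<close>; all
  three equivalences are instances of this one (\<open>BPBp_RSE_iff_uniformly_convex\<close>).

  Necessity (\<open>BPBp_RSE_imp_uniformly_convex\<close>). Let \<open>u1\<close>, \<open>u2\<close> be norm-one functions with disjoint
  supports and let \<open>y1\<close>, \<open>y2\<close> be unit vectors whose midpoint is almost a unit vector. The
  norm-one operator \<open>T\<close> that integrates against the conjugate signs of \<open>u1\<close> and \<open>u2\<close> and
  multiplies by \<open>y1\<close> and \<open>y2\<close> almost attains its norm at \<open>(u1 + u2) / 2\<close>. Take \<open>S\<close> and \<open>g\<close>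
  from the property and cut \<open>g\<close> along the support of \<open>u1\<close>. Since \<open>S g\<close> is a unit vector, \<open>S\<close>
  attains its norm at both normalized pieces \<open>v1\<close>, \<open>v2\<close>. Range strong exposure, applied to constant
  sequences, makes \<open>S v1\<close> and \<open>S v2\<close> unimodular multiples of one vector; because a proper convex
  combination of them is still a unit vector, strict convexity of the scalar field gives
  \<open>S v1 = S v2\<close>. But \<open>S v1\<close> is close to \<open>y1\<close> and \<open>S v2\<close> is close to \<open>y2\<close>.

  Sufficiency (\<open>uniformly_convex_imp_BPBp_RSE\<close>). Let \<open>T\<close> and \<open>f\<close> have norm one with \<open>T f\<close> almost a
  unit vector, let \<open>y\<close> be \<open>T f\<close> normalized and let \<open>\<nu>\<close> be the measure with density \<open>|f|\<close>. A set \<open>E\<close>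
  is bad if the norm of \<open>T (f 1\<^sub>E) + \<nu>(E) y\<close> is at most \<open>(2 - 2 \<delta>) \<nu>(E)\<close>. Bad sets are closed under
  disjoint unions and increasing limits, so there is a bad set \<open>B\<close> outside of which all bad sets are
  null (\<open>exhaustion\<close>). As \<open>T f + y\<close> has norm almost two, \<open>\<nu>(B)\<close> is small. On the rest \<open>A\<close> of the
  support of \<open>f\<close>, uniform convexity puts \<open>T (f 1\<^sub>E)\<close> near \<open>\<nu>(E) y\<close> for every \<open>E\<close>, and by passing
  from sets to functions \<open>T\<close> is near the rank-one operator \<open>\<phi> \<mapsto> (\<integral> \<phi> |f| / f) y\<close> on functions
  that live on \<open>A\<close> (\<open>almost_rank_one_on_large_set\<close>). Let \<open>S\<close> be that operator on \<open>A\<close> and a slightly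
  shrunk copy of \<open>T\<close> off \<open>A\<close>. It attains its norm at the normalized restriction of \<open>f\<close> to \<open>A\<close>, and
  a norming sequence must concentrate on \<open>A\<close>, where the image is one-dimensional; compactness of the
  scalar unit ball then yields the required subsequence.
\<close>

section \<open>The scalar field\<close>

text \<open>Case distinction between the two possible scalar fields, used below to transport facts about
  \<open>real\<close> and \<open>complex\<close> along an isometry.\<close>

lemma scalar_model:
  fixes P :: "bool"
  assumes real: "\<And>f :: 'k::real_or_complex \<Rightarrow> real. bij f \<Longrightarrow> linear f \<Longrightarrow> (\<And>x. norm (f x) = norm x) \<Longrightarrow> P"
    and complex: "\<And>f :: 'k \<Rightarrow> complex. bij f \<Longrightarrow> linear f \<Longrightarrow> (\<And>x. norm (f x) = norm x) \<Longrightarrow> P"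
  shows P
proof -
  consider f :: "'k \<Rightarrow> real" where "bij f" "linear f" "\<And>x. norm (f x) = norm x"
    | f :: "'k \<Rightarrow> complex" where "bij f" "linear f" "\<And>x. norm (f x) = norm x"
    using real_or_complex[where 'a='k] by (metis linearI)
  then show P using real complex by cases blast+
qed

text \<open>Bolzano-Weierstrass for the abstract scalar field.\<close>

lemma scalar_bounded_subsequence:
  fixes a :: "nat \<Rightarrow> 'k::real_or_complex"
  assumes "\<And>n. norm (a n) \<le> C"
  obtains \<sigma> :: "nat \<Rightarrow> nat" and l where "strict_mono \<sigma>" "(\<lambda>n. a (\<sigma> n)) \<longlonglongrightarrow> l"
proof -
  have *: "\<exists>\<sigma> l. strict_mono \<sigma> \<and> (\<lambda>n. a (\<sigma> n)) \<longlonglongrightarrow> l"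
    if f: "bij f" "linear f" "\<And>x. norm (f x) = norm x"
    for f :: "'k \<Rightarrow> 'e::{real_normed_vector, heine_borel}"
  proof -
    have "bounded (range (f \<circ> a))" using assms by (auto simp: bounded_iff f(3))
    then obtain \<sigma> l where \<sigma>: "strict_mono \<sigma>" "(f \<circ> a \<circ> \<sigma>) \<longlonglongrightarrow> l"
      using bounded_imp_convergent_subsequence by blast
    obtain l' where "l = f l'" using \<open>bij f\<close> by (meson bij_pointE)
    then have "norm (f (a (\<sigma> n)) - l) = norm (a (\<sigma> n) - l')" for n
      using f by (metis linear_diff)
    moreover have "(\<lambda>n. norm (f (a (\<sigma> n)) - l)) \<longlonglongrightarrow> 0"
      using \<sigma>(2) by (simp add: o_def LIM_zero tendsto_norm_zero)
    ultimately have "(\<lambda>n. a (\<sigma> n)) \<longlonglongrightarrow> l'"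
      by (simp add: tendsto_norm_zero_iff LIM_zero_iff)
    then show ?thesis using \<sigma>(1) by blast
  qed
  show ?thesis
    by (rule scalar_model[where 'k='k]) (use * that in blast)+
qed

text \<open>Expanding the square of the norm of the convex combination forces the inner product of the two
  vectors to be one.\<close>

lemma inner_strictly_convex:
  fixes a b :: "'e::real_inner"
  assumes "norm a = 1" "norm b = 1" "p > 0" "q > 0" "p + q = 1" "norm (p *\<^sub>R a + q *\<^sub>R b) = 1"
  shows "a = b"
proof -
  have aa: "inner a a = 1" "inner b b = 1" using assms by (simp_all add: norm_eq_1)
  have "inner (p *\<^sub>R a + q *\<^sub>R b) (p *\<^sub>R a + q *\<^sub>R b) = 1" using assms(6) by (simp add: norm_eq_1)
  then have "p * p + q * q + 2 * (p * q) * inner a b = 1"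
    using aa by (simp add: inner_add_left inner_add_right inner_commute algebra_simps)
  moreover have "p * p + q * q + 2 * (p * q) * inner a b
      = (p + q) * (p + q) + 2 * (p * q) * (inner a b - 1)"
    by (simp add: algebra_simps)
  ultimately have "2 * (p * q) * (inner a b - 1) = 0" using \<open>p + q = 1\<close> by simp
  then have "inner a b = 1" using assms by simp
  then have "inner (a - b) (a - b) = 0"
    using aa by (simp add: inner_diff_left inner_diff_right inner_commute)
  then show ?thesis by simp
qed

lemma scalar_strictly_convex:
  fixes a b :: "'k::real_or_complex"
  assumes ab: "norm a = 1" "norm b = 1" "p > 0" "q > 0" "p + q = 1" "norm (p *\<^sub>R a + q *\<^sub>R b) = 1"
  shows "a = b"
proof -
  have *: "a = b" if f: "bij f" "linear f" "\<And>x. norm (f x) = norm x"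
    for f :: "'k \<Rightarrow> 'e::real_inner"
  proof -
    have "f a = f b"
    proof (rule inner_strictly_convex[of _ _ p q])
      have "p *\<^sub>R f a + q *\<^sub>R f b = f (p *\<^sub>R a + q *\<^sub>R b)"
        by (simp add: linear_add[OF f(2)] linear_scale[OF f(2)])
      then show "norm (p *\<^sub>R f a + q *\<^sub>R f b) = 1" using f(3) ab(6) by simp
    qed (use f ab in auto)
    then show ?thesis using f(1) by (meson bij_is_inj injD)
  qed
  show ?thesis by (rule scalar_model[where 'k='k]) (use * in blast)+
qed

section \<open>Norms and sign integrals of integrable functions\<close>

abbreviation L1norm :: "'a measure \<Rightarrow> ('a \<Rightarrow> 'b::real_normed_vector) \<Rightarrow> real" where
  "L1norm M f \<equiv> LINT w|M. norm (f w)"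

lemma integrable_restrict_minus:
  fixes \<phi> :: "'a \<Rightarrow> 'b::{banach, second_countable_topology}"
  assumes "A \<in> sets M" "integrable M \<phi>"
  shows "integrable M (\<lambda>w. indicator A w *\<^sub>R \<phi> w)" "integrable M (\<lambda>w. indicator (space M - A) w *\<^sub>R \<phi> w)"
  using assms by (auto intro!: integrable_mult_indicator)

lemma L1norm_scaleR: "L1norm M (\<lambda>w. r *\<^sub>R f w) = \<bar>r\<bar> * L1norm M f"
  by simp

lemma L1norm_split:
  fixes \<phi> :: "'a \<Rightarrow> 'b::{banach, second_countable_topology}"
  assumes "A \<in> sets M" "integrable M \<phi>"
  shows "L1norm M \<phi> =
    L1norm M (\<lambda>w. indicator A w *\<^sub>R \<phi> w) + L1norm M (\<lambda>w. indicator (space M - A) w *\<^sub>R \<phi> w)"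
proof -
  have "L1norm M \<phi> = (LINT w|M. norm (indicator A w *\<^sub>R \<phi> w) + norm (indicator (space M - A) w *\<^sub>R \<phi> w))"
    by (intro Bochner_Integration.integral_cong) (auto simp: indicator_def)
  also have "\<dots> = L1norm M (\<lambda>w. indicator A w *\<^sub>R \<phi> w) + L1norm M (\<lambda>w. indicator (space M - A) w *\<^sub>R \<phi> w)"
    using integrable_restrict_minus[OF assms] by (intro Bochner_Integration.integral_add integrable_norm)
  finally show ?thesis .
qed

lemma L1norm_triangle:
  fixes f g :: "'a \<Rightarrow> 'b::{banach, second_countable_topology}"
  assumes "integrable M f" "integrable M g"
  shows "L1norm M (\<lambda>w. f w + g w) \<le> L1norm M f + L1norm M g"
proof -
  have "L1norm M (\<lambda>w. f w + g w) \<le> (LINT w|M. norm (f w) + norm (g w))"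
    using assms by (intro integral_mono) (auto simp: norm_triangle_ineq)
  also have "\<dots> = L1norm M f + L1norm M g" using assms by simp
  finally show ?thesis .
qed

lemma L1norm_pos:
  fixes f :: "'a \<Rightarrow> 'b::{banach, second_countable_topology}"
  assumes "integrable M f" "\<not> (AE w in M. f w = 0)"
  shows "L1norm M f > 0"
proof -
  have "L1norm M f \<noteq> 0"
    using assms by (subst integral_nonneg_eq_0_iff_AE) auto
  then show ?thesis by (simp add: less_le)
qed

text \<open>Integration of \<open>\<phi>\<close> against the conjugate of the sign of \<open>g\<close>. The quotient \<open>|g| / g\<close> expresses the
  conjugate sign with field operations only, so one formula serves both scalar fields, and the
  convention \<open>x / 0 = 0\<close> restricts the integral to the support of \<open>g\<close>. It is the norm-one functional
  that attains its norm at \<open>g\<close>.\<close>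

definition sign_integral :: "'a measure \<Rightarrow> ('a \<Rightarrow> 'k::real_or_complex) \<Rightarrow> ('a \<Rightarrow> 'k) \<Rightarrow> 'k" where
  "sign_integral M g \<phi> = (LINT w|M. \<phi> w * (of_real (norm (g w)) / g w))"

lemma sign_integrable:
  fixes g :: "'a \<Rightarrow> 'k::real_or_complex"
  assumes [measurable]: "g \<in> borel_measurable M" and "integrable M \<phi>"
  shows "integrable M (\<lambda>w. \<phi> w * (of_real (norm (g w)) / g w))"
proof (rule Bochner_Integration.integrable_bound[OF assms(2)])
  have [measurable]: "\<phi> \<in> borel_measurable M" "(of_real :: real \<Rightarrow> 'k) \<in> borel_measurable borel"
    using assms(2) by (auto intro!: borel_measurable_continuous_onI continuous_intros)
  show "(\<lambda>w. \<phi> w * (of_real (norm (g w)) / g w)) \<in> borel_measurable M"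
    by measurable
qed (auto simp: norm_mult norm_divide divide_simps)

lemma norm_sign_integral_le:
  assumes "g \<in> borel_measurable M" and "integrable M \<phi>"
  shows "norm (sign_integral M g \<phi>) \<le> L1norm M \<phi>"
proof -
  have "norm (sign_integral M g \<phi>) \<le> (LINT w|M. norm (\<phi> w * (of_real (norm (g w)) / g w)))"
    unfolding sign_integral_def by (rule integral_norm_bound)
  also have "\<dots> \<le> L1norm M \<phi>"
    by (intro integral_mono integrable_norm sign_integrable assms)
       (auto simp: norm_mult norm_divide divide_simps)
  finally show ?thesis .
qed

lemma sign_integral_self:
  fixes g :: "'a \<Rightarrow> 'k::real_or_complex"
  assumes "E \<in> sets M" "integrable M g"
  shows "sign_integral M g (\<lambda>w. indicator E w *\<^sub>R g w)
    = of_real (L1norm M (\<lambda>w. indicator E w *\<^sub>R g w))"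
proof -
  have "sign_integral M g (\<lambda>w. indicator E w *\<^sub>R g w)
      = (LINT w|M. of_real (norm (indicator E w *\<^sub>R g w)))"
    unfolding sign_integral_def
    by (intro Bochner_Integration.integral_cong refl) (auto simp: indicator_def)
  also have "\<dots> = of_real (L1norm M (\<lambda>w. indicator E w *\<^sub>R g w))"
    using integrable_mult_indicator[OF assms]
    by (intro integral_bounded_linear bounded_linear_of_real integrable_norm)
  finally show ?thesis .
qed

lemma sign_integral_scaleR: "sign_integral M g (\<lambda>w. r *\<^sub>R \<phi> w) = r *\<^sub>R sign_integral M g \<phi>"
  by (simp only: sign_integral_def mult_scaleR_left integral_scaleR_right)

lemma sign_integral_cong:
  assumes "\<And>w. w \<in> space M \<Longrightarrow> g w \<noteq> 0 \<Longrightarrow> \<phi> w = \<psi> w"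
  shows "sign_integral M g \<phi> = sign_integral M g \<psi>"
  unfolding sign_integral_def
proof (rule Bochner_Integration.integral_cong[OF refl])
  show "\<phi> w * (of_real (norm (g w)) / g w) = \<psi> w * (of_real (norm (g w)) / g w)"
    if "w \<in> space M" for w
    using assms[OF that] by (cases "g w = 0") auto
qed

lemma sign_integral_zero: "sign_integral M g (\<lambda>w. 0) = 0"
  by (simp add: sign_integral_def)

lemma sign_integral_diag:
  assumes "integrable M g"
  shows "sign_integral M g g = of_real (L1norm M g)"
proof -
  have "sign_integral M g g = sign_integral M g (\<lambda>w. indicator (space M) w *\<^sub>R g w)"
    by (rule sign_integral_cong) simp
  also have "\<dots> = of_real (L1norm M (\<lambda>w. indicator (space M) w *\<^sub>R g w))"
    using assms by (intro sign_integral_self) auto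
  also have "L1norm M (\<lambda>w. indicator (space M) w *\<^sub>R g w) = L1norm M g"
    by (intro Bochner_Integration.integral_cong) auto
  finally show ?thesis .
qed

section \<open>Bounded operators on integrable functions\<close>

text \<open>Operators are studied on integrable functions rather than on the points of a domain space, so
  that the same results apply to classes of functions and to sequences. The constant \<open>K\<close> is a bound
  for the norm, not the norm itself.\<close>

locale L1_operator = banach_over smul
  for smul :: "'k::real_or_complex \<Rightarrow> 'y::banach \<Rightarrow> 'y" +
  fixes M :: "'a measure" and \<tau> :: "('a \<Rightarrow> 'k) \<Rightarrow> 'y" and K :: real
  assumes op_add: "integrable M f \<Longrightarrow> integrable M g \<Longrightarrow> \<tau> (\<lambda>w. f w + g w) = \<tau> f + \<tau> g"
    and op_scale: "integrable M f \<Longrightarrow> \<tau> (\<lambda>w. c * f w) = smul c (\<tau> f)"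
    and op_bound: "integrable M f \<Longrightarrow> norm (\<tau> f) \<le> K * L1norm M f"
begin

lemma op_diff:
  assumes "integrable M f" "integrable M g"
  shows "\<tau> (\<lambda>w. f w - g w) = \<tau> f - \<tau> g"
proof -
  have "\<tau> (\<lambda>w. (f w - g w) + g w) = \<tau> (\<lambda>w. f w - g w) + \<tau> g"
    using assms by (intro op_add) auto
  then show ?thesis by simp
qed

lemma op_scaleR:
  assumes "integrable M f"
  shows "\<tau> (\<lambda>w. r *\<^sub>R f w) = r *\<^sub>R \<tau> f"
  using op_scale[OF assms, of "of_real r"] by (simp add: scaleR_conv_of_real[symmetric] smul_of_real)

lemma op_zero: "\<tau> (\<lambda>w. 0) = 0"
  using op_bound[of "\<lambda>w. 0"] by simp

text \<open>The bound alone makes the operator insensitive to null sets.\<close>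

lemma op_cong_AE:
  assumes "integrable M f" "integrable M g" "AE w in M. f w = g w"
  shows "\<tau> f = \<tau> g"
proof -
  have "L1norm M (\<lambda>w. f w - g w) = 0"
    using assms(3) by (intro integral_eq_zero_AE) auto
  then have "norm (\<tau> f - \<tau> g) \<le> 0"
    using op_bound[of "\<lambda>w. f w - g w"] assms by (simp add: op_diff)
  then show ?thesis by simp
qed

lemma op_sum:
  assumes "finite I" "\<And>i. i \<in> I \<Longrightarrow> integrable M (f i)"
  shows "\<tau> (\<lambda>w. \<Sum>i\<in>I. f i w) = (\<Sum>i\<in>I. \<tau> (f i))"
  using assms by (induction I rule: finite_induct) (auto simp: op_zero op_add)

lemma op_dominated_convergence:
  assumes "\<phi> \<in> borel_measurable M" "\<And>n. s n \<in> borel_measurable M" "integrable M h"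
    and "AE w in M. (\<lambda>n. s n w) \<longlonglongrightarrow> \<phi> w" "\<And>n. AE w in M. norm (s n w) \<le> h w"
  shows "(\<lambda>n. \<tau> (s n)) \<longlonglongrightarrow> \<tau> \<phi>"
proof -
  note D = assms(1-3) assms(4) assms(5)
  have int: "integrable M \<phi>" "\<And>n. integrable M (s n)"
    using integrable_dominated_convergence[OF D] integrable_dominated_convergence2[OF D] by blast+
  have "(\<lambda>n. L1norm M (\<lambda>w. s n w - \<phi> w)) \<longlonglongrightarrow> (LINT w|M. 0)"
  proof (rule integral_dominated_convergence[where w="\<lambda>w. h w + norm (\<phi> w)"])
    show "AE w in M. (\<lambda>n. norm (s n w - \<phi> w)) \<longlonglongrightarrow> 0"
      using assms(4) by eventually_elim (simp add: LIM_zero tendsto_norm_zero)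
    show "AE w in M. norm (norm (s n w - \<phi> w)) \<le> h w + norm (\<phi> w)" for n
      using assms(5)[of n] by eventually_elim (simp add: norm_triangle_le_diff)
  qed (use assms int in auto)
  then have "(\<lambda>n. K * L1norm M (\<lambda>w. s n w - \<phi> w)) \<longlonglongrightarrow> 0"
    by (simp add: tendsto_mult_right_zero)
  then have "(\<lambda>n. \<tau> (s n) - \<tau> \<phi>) \<longlonglongrightarrow> 0"
    by (rule Lim_null_comparison[rotated])
       (use op_bound[of "\<lambda>w. s _ w - \<phi> w"] int in \<open>auto simp: op_diff\<close>)
  then show ?thesis by (simp add: LIM_zero_iff)
qed

text \<open>A bound on the multiples of \<open>g\<close> by indicator functions extends to all functions supported
  where \<open>g\<close> is: on \<open>s g\<close> with \<open>s\<close> simple, the triangle inequality loses nothing, because the level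
  sets of \<open>s\<close> are disjoint and the norm of the domain is additive over disjoint supports. The general
  \<open>\<phi>\<close> is a dominated limit of such products, since \<open>\<phi> / g\<close> is a limit of simple functions.\<close>

lemma bound_from_sets:
  assumes g: "integrable M g"
    and sets: "\<And>E. E \<in> sets M \<Longrightarrow>
      norm (\<tau> (\<lambda>w. indicator E w *\<^sub>R g w)) \<le> e * L1norm M (\<lambda>w. indicator E w *\<^sub>R g w)"
    and \<phi>: "integrable M \<phi>" "\<And>w. g w = 0 \<Longrightarrow> \<phi> w = 0"
  shows "norm (\<tau> \<phi>) \<le> e * L1norm M \<phi>"
proof -
  have [measurable]: "g \<in> borel_measurable M" "\<phi> \<in> borel_measurable M" using g \<phi> by auto
  have simple: "integrable M (\<lambda>w. s w * g w) \<and>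
      norm (\<tau> (\<lambda>w. s w * g w)) \<le> e * L1norm M (\<lambda>w. s w * g w)"
    if s: "simple_function M s" for s
  proof -
    let ?I = "s ` space M" and ?E = "\<lambda>y. s -` {y} \<inter> space M"
    have fin: "finite ?I" and E: "?E y \<in> sets M" for y
      using s by (auto simp: simple_functionD)
    have int: "integrable M (\<lambda>w. indicator (?E y) w *\<^sub>R g w)" for y
      by (rule integrable_mult_indicator[OF E g])
    have rep: "(\<Sum>y\<in>?I. c y * (indicator (?E y) w *\<^sub>R z)) = c (s w) * z"
      if "w \<in> space M" for w and c :: "'k \<Rightarrow> 'b::real_normed_field" and z
    proof -
      have "(\<Sum>y\<in>?I. c y * (indicator (?E y) w *\<^sub>R z)) = (\<Sum>y\<in>?I. if s w = y then c y * z else 0)"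
        using that by (intro sum.cong) (auto simp: indicator_def)
      then show ?thesis using that fin by simp
    qed
    have sum: "integrable M (\<lambda>w. \<Sum>y\<in>?I. y * (indicator (?E y) w *\<^sub>R g w))"
      by (intro Bochner_Integration.integrable_sum impI integrable_mult_right int)
    then have int_s: "integrable M (\<lambda>w. s w * g w)"
      by (rule Bochner_Integration.integrable_cong[OF refl, THEN iffD1, rotated]) (rule rep)
    have "\<tau> (\<lambda>w. s w * g w) = \<tau> (\<lambda>w. \<Sum>y\<in>?I. y * (indicator (?E y) w *\<^sub>R g w))"
      using rep[of _ "\<lambda>y. y"] by (intro op_cong_AE int_s sum) auto
    also have "\<dots> = (\<Sum>y\<in>?I. smul y (\<tau> (\<lambda>w. indicator (?E y) w *\<^sub>R g w)))"
      by (simp add: op_sum fin integrable_mult_right int op_scale del: mult_scaleR_right)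
    also have "norm \<dots> \<le> (\<Sum>y\<in>?I. norm y * (e * L1norm M (\<lambda>w. indicator (?E y) w *\<^sub>R g w)))"
      using sets[OF E] by (intro sum_norm_le) (simp add: norm_smul mult_left_mono)
    also have "\<dots> = e * (LINT w|M. (\<Sum>y\<in>?I. norm y * (indicator (?E y) w *\<^sub>R norm (g w))))"
    proof -
      have "integrable M (\<lambda>w. indicator (?E y) w * norm (g w))" for y
        using int[of y, THEN integrable_norm] by simp
      then show ?thesis by (simp add: sum_distrib_left mult_ac)
    qed
    also have "(LINT w|M. (\<Sum>y\<in>?I. norm y * (indicator (?E y) w *\<^sub>R norm (g w))))
        = L1norm M (\<lambda>w. s w * g w)"
      by (intro Bochner_Integration.integral_cong refl) (simp only: rep norm_mult)
    finally show ?thesis using int_s by blast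
  qed
  have "(\<lambda>w. \<phi> w / g w) \<in> borel_measurable M" by measurable
  from borel_measurable_implies_sequence_metric[OF this, of 0]
  obtain s where s: "simple_function M (s i)"
    and lim: "w \<in> space M \<Longrightarrow> (\<lambda>i. s i w) \<longlonglongrightarrow> \<phi> w / g w"
    and dom: "w \<in> space M \<Longrightarrow> dist (s i w) 0 \<le> 2 * dist (\<phi> w / g w) 0" for i w
    by metis
  have [measurable]: "s i \<in> borel_measurable M" for i
    by (rule borel_measurable_simple_function[OF s])
  have lim': "AE w in M. (\<lambda>i. s i w * g w) \<longlonglongrightarrow> \<phi> w"
  proof (rule AE_I2)
    fix w assume "w \<in> space M"
    then have "(\<lambda>i. s i w * g w) \<longlonglongrightarrow> \<phi> w / g w * g w" by (intro tendsto_mult lim) auto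
    then show "(\<lambda>i. s i w * g w) \<longlonglongrightarrow> \<phi> w" using \<phi>(2)[of w] by (cases "g w = 0") auto
  qed
  have dom': "AE w in M. norm (s i w * g w) \<le> 2 * norm (\<phi> w)" for i
  proof (rule AE_I2)
    fix w assume "w \<in> space M"
    then have "norm (s i w) \<le> 2 * norm (\<phi> w / g w)" using dom by auto
    then have "norm (s i w) * norm (g w) \<le> 2 * norm (\<phi> w / g w) * norm (g w)"
      by (rule mult_right_mono) simp
    also have "\<dots> \<le> 2 * norm (\<phi> w)" by (cases "g w = 0") (auto simp: norm_divide)
    finally show "norm (s i w * g w) \<le> 2 * norm (\<phi> w)" by (simp add: norm_mult)
  qed
  have "(\<lambda>i. \<tau> (\<lambda>w. s i w * g w)) \<longlonglongrightarrow> \<tau> \<phi>"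
    by (rule op_dominated_convergence[where h="\<lambda>w. 2 * norm (\<phi> w)"])
       (use lim' dom' \<phi>(1) in simp_all)
  then have "(\<lambda>i. norm (\<tau> (\<lambda>w. s i w * g w))) \<longlonglongrightarrow> norm (\<tau> \<phi>)"
    by (rule tendsto_norm)
  moreover have "(\<lambda>i. L1norm M (\<lambda>w. s i w * g w)) \<longlonglongrightarrow> L1norm M \<phi>"
  proof (rule integral_dominated_convergence[where w="\<lambda>w. 2 * norm (\<phi> w)"])
    show "AE w in M. (\<lambda>i. norm (s i w * g w)) \<longlonglongrightarrow> norm (\<phi> w)"
      using lim' by eventually_elim (rule tendsto_norm)
    show "AE w in M. norm (norm (s i w * g w)) \<le> 2 * norm (\<phi> w)" for i
      using dom'[of i] by simp
  qed (use \<phi>(1) in auto)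
  then have "(\<lambda>i. e * L1norm M (\<lambda>w. s i w * g w)) \<longlonglongrightarrow> e * L1norm M \<phi>"
    by (rule tendsto_mult_left)
  ultimately show ?thesis
    by (rule LIMSEQ_le) (use simple[OF s] in blast)
qed

end

lemma (in L1_operator) op_split:
  assumes "A \<in> sets M" "integrable M \<phi>"
  shows "\<tau> \<phi> = \<tau> (\<lambda>w. indicator A w *\<^sub>R \<phi> w) + \<tau> (\<lambda>w. indicator (space M - A) w *\<^sub>R \<phi> w)"
proof -
  have "\<tau> \<phi> = \<tau> (\<lambda>w. indicator A w *\<^sub>R \<phi> w + indicator (space M - A) w *\<^sub>R \<phi> w)"
    using assms integrable_restrict_minus[OF assms]
    by (intro op_cong_AE AE_I2 Bochner_Integration.integrable_add) (auto simp: indicator_def)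
  then show ?thesis using integrable_restrict_minus[OF assms] by (simp add: op_add)
qed

lemma (in L1_operator) L1_operator_rebound:
  assumes "\<And>f. integrable M f \<Longrightarrow> norm (\<tau> f) \<le> C * L1norm M f"
  shows "L1_operator smul M \<tau> C"
  by unfold_locales (use op_add op_scale assms in auto)

lemma (in banach_over) sign_operator:
  fixes g :: "'c \<Rightarrow> 'k"
  assumes "g \<in> borel_measurable M"
  shows "L1_operator smul M (\<lambda>\<phi>. smul (sign_integral M g \<phi>) y) (norm y)"
proof
  note int = sign_integrable[OF assms]
  fix \<phi> \<psi> :: "'c \<Rightarrow> 'k" and c assume \<phi>: "integrable M \<phi>"
  show "smul (sign_integral M g (\<lambda>w. c * \<phi> w)) y = smul c (smul (sign_integral M g \<phi>) y)"
    by (simp add: sign_integral_def mult.assoc del: times_divide_eq_right)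
  show "norm (smul (sign_integral M g \<phi>) y) \<le> norm y * L1norm M \<phi>"
    using norm_sign_integral_le[OF assms \<phi>] by (simp add: norm_smul mult.commute mult_left_mono)
  assume \<psi>: "integrable M \<psi>"
  show "smul (sign_integral M g (\<lambda>w. \<phi> w + \<psi> w)) y
      = smul (sign_integral M g \<phi>) y + smul (sign_integral M g \<psi>) y"
    using int[OF \<phi>] int[OF \<psi>] by (simp add: sign_integral_def distrib_right scale_left_distrib del: times_divide_eq_right)
qed

lemma (in banach_over) L1_operator_plus:
  assumes "L1_operator smul M \<tau> K" "L1_operator smul M \<tau>' K'"
  shows "L1_operator smul M (\<lambda>\<phi>. \<tau> \<phi> + \<tau>' \<phi>) (K + K')"
proof -
  interpret a: L1_operator smul M \<tau> K by fact
  interpret b: L1_operator smul M \<tau>' K' by fact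
  show ?thesis
    by unfold_locales
      (auto simp: a.op_add b.op_add a.op_scale b.op_scale scale_right_distrib distrib_right
        intro!: norm_triangle_mono a.op_bound b.op_bound)
qed

lemma (in banach_over) L1_operator_scaleR:
  fixes \<tau> :: "('c \<Rightarrow> 'k) \<Rightarrow> 'y"
  assumes "L1_operator smul M \<tau> K"
  shows "L1_operator smul M (\<lambda>\<phi>. r *\<^sub>R \<tau> \<phi>) (\<bar>r\<bar> * K)"
proof -
  interpret a: L1_operator smul M \<tau> K by fact
  show ?thesis
  proof
    fix \<phi> :: "'c \<Rightarrow> 'k" and c assume \<phi>: "integrable M \<phi>"
    show "r *\<^sub>R \<tau> (\<lambda>w. c * \<phi> w) = smul c (r *\<^sub>R \<tau> \<phi>)"
      by (simp add: a.op_scale[OF \<phi>] smul_of_real[symmetric] scale_left_commute)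
    show "norm (r *\<^sub>R \<tau> \<phi>) \<le> \<bar>r\<bar> * K * L1norm M \<phi>"
      using mult_left_mono[OF a.op_bound[OF \<phi>], of "\<bar>r\<bar>"] by (simp add: mult.assoc)
  qed (simp add: a.op_add scaleR_right_distrib)
qed

lemma (in L1_operator) L1_operator_restrict:
  assumes "A \<in> sets M" "K \<ge> 0"
  shows "L1_operator smul M (\<lambda>\<phi>. \<tau> (\<lambda>w. indicator A w *\<^sub>R \<phi> w)) K"
proof
  fix \<phi> \<psi> :: "'a \<Rightarrow> 'k" and c assume \<phi>: "integrable M \<phi>"
  note int = integrable_mult_indicator[OF assms(1)]
  show "\<tau> (\<lambda>w. indicator A w *\<^sub>R (c * \<phi> w)) = smul c (\<tau> (\<lambda>w. indicator A w *\<^sub>R \<phi> w))"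
    using op_scale[OF int[OF \<phi>], of c] by simp
  have "norm (\<tau> (\<lambda>w. indicator A w *\<^sub>R \<phi> w)) \<le> K * L1norm M (\<lambda>w. indicator A w *\<^sub>R \<phi> w)"
    by (rule op_bound[OF int[OF \<phi>]])
  also have "\<dots> \<le> K * L1norm M \<phi>"
    using L1norm_split[OF assms(1) \<phi>] assms(2) by (intro mult_left_mono) auto
  finally show "norm (\<tau> (\<lambda>w. indicator A w *\<^sub>R \<phi> w)) \<le> K * L1norm M \<phi>" .
  assume \<psi>: "integrable M \<psi>"
  show "\<tau> (\<lambda>w. indicator A w *\<^sub>R (\<phi> w + \<psi> w))
      = \<tau> (\<lambda>w. indicator A w *\<^sub>R \<phi> w) + \<tau> (\<lambda>w. indicator A w *\<^sub>R \<psi> w)"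
    using op_add[OF int[OF \<phi>] int[OF \<psi>]] by (simp add: scaleR_right_distrib)
qed

section \<open>Spaces modelled on integrable functions\<close>

text \<open>The map \<open>cls\<close> sends a function to the point it represents. That it identifies only functions that
  agree almost everywhere follows from the norm (\<open>cls_eq_AE\<close>).\<close>

locale L1_model =
  fixes X :: "('k::real_or_complex, 'x) nspace" and M :: "'a measure" and cls :: "('a \<Rightarrow> 'k) \<Rightarrow> 'x"
  assumes points: "points X = cls ` {f. integrable M f}"
    and add_cls: "integrable M f \<Longrightarrow> integrable M g \<Longrightarrow> add X (cls f) (cls g) = cls (\<lambda>w. f w + g w)"
    and smult_cls: "integrable M f \<Longrightarrow> smult X c (cls f) = cls (\<lambda>w. c * f w)"
    and nrm_cls: "integrable M f \<Longrightarrow> nrm X (cls f) = L1norm M f"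
begin

lemma minus_cls:
  assumes "integrable M f" "integrable M g"
  shows "minus_in X (cls f) (cls g) = cls (\<lambda>w. f w - g w)"
  unfolding minus_in_def using assms by (simp add: smult_cls add_cls)

lemma cls_eq_AE:
  assumes fg: "integrable M f" "integrable M g" and "cls f = cls g"
  shows "AE w in M. f w = g w"
proof -
  have "cls (\<lambda>w. f w - g w) = cls (\<lambda>w. g w - g w)"
    using assms minus_cls by metis
  then have "L1norm M (\<lambda>w. f w - g w) = L1norm M (\<lambda>w. g w - g w)"
    using fg by (metis nrm_cls Bochner_Integration.integrable_diff)
  then have "L1norm M (\<lambda>w. f w - g w) = 0" by simp
  then have "AE w in M. norm (f w - g w) = 0"
    using fg by (subst (asm) integral_nonneg_eq_0_iff_AE) auto
  then show ?thesis by eventually_elim simp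
qed

lemma unit_ball_cls: "unit_ball X = cls ` {f. integrable M f \<and> L1norm M f \<le> 1}"
  by (auto simp: unit_ball_def points nrm_cls)

lemma unit_sphere_cls: "unit_sphere X = cls ` {f. integrable M f \<and> L1norm M f = 1}"
  by (auto simp: unit_sphere_def points nrm_cls)

definition rep :: "'x \<Rightarrow> 'a \<Rightarrow> 'k" where
  "rep z = (SOME f. integrable M f \<and> cls f = z)"

lemma rep_cls:
  assumes "integrable M f"
  shows "integrable M (rep (cls f))" "cls (rep (cls f)) = cls f"
  using someI[of "\<lambda>g. integrable M g \<and> cls g = cls f" f] assms by (auto simp: rep_def)

lemma op_norm_le:
  assumes "\<And>f. integrable M f \<Longrightarrow> L1norm M f \<le> 1 \<Longrightarrow> norm (T (cls f)) \<le> C"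
  shows "op_norm X T \<le> C"
  unfolding op_norm_def
proof (rule cSUP_least)
  show "unit_ball X \<noteq> {}" by (auto simp: unit_ball_cls intro!: exI[of _ "\<lambda>w. 0"])
qed (use assms in \<open>auto simp: unit_ball_cls\<close>)

text \<open>The bound in the premise makes the supremum in the operator norm one of a bounded set.\<close>

lemma op_norm_ge:
  assumes "\<And>f. integrable M f \<Longrightarrow> norm (T (cls f)) \<le> C * L1norm M f"
    and f: "integrable M f" "L1norm M f \<le> 1"
  shows "norm (T (cls f)) \<le> op_norm X T"
  unfolding op_norm_def
proof (rule cSUP_upper)
  show "cls f \<in> unit_ball X" using f by (auto simp: unit_ball_cls)
  have "norm (T (cls g)) \<le> \<bar>C\<bar>" if g: "integrable M g" "L1norm M g \<le> 1" for g
  proof -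
    have "norm (T (cls g)) \<le> C * L1norm M g" using assms(1)[OF g(1)] .
    also have "\<dots> \<le> \<bar>C\<bar> * L1norm M g" by (intro mult_right_mono) auto
    also have "\<dots> \<le> \<bar>C\<bar> * 1" using g by (intro mult_left_mono) auto
    finally show ?thesis by simp
  qed
  then show "bdd_above ((\<lambda>x. norm (T x)) ` unit_ball X)"
    by (intro bdd_aboveI[of _ "\<bar>C\<bar>"]) (auto simp: unit_ball_cls)
qed

end

locale L1_model_banach = L1_model X M cls + banach_over smul
  for X :: "('k::real_or_complex, 'x) nspace" and M :: "'a measure" and cls
    and smul :: "'k \<Rightarrow> 'y::banach \<Rightarrow> 'y"
begin

lemma bounded_op_iff:
  "T \<in> bounded_ops X smul \<longleftrightarrow> (\<exists>K. L1_operator smul M (\<lambda>f. T (cls f)) K)"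
proof
  assume T: "T \<in> bounded_ops X smul"
  then obtain K where K: "\<And>x. x \<in> points X \<Longrightarrow> norm (T x) \<le> K * nrm X x"
    unfolding bounded_ops_def by blast
  have "L1_operator smul M (\<lambda>f. T (cls f)) K"
  proof
    fix f g :: "'a \<Rightarrow> 'k" and c assume f: "integrable M f"
    then have f': "cls f \<in> points X" by (auto simp: points)
    show "norm (T (cls f)) \<le> K * L1norm M f" using K[OF f'] f by (simp add: nrm_cls)
    show "T (cls (\<lambda>w. c * f w)) = smul c (T (cls f))"
      using T f f' by (auto simp: bounded_ops_def smult_cls[symmetric])
    assume g: "integrable M g"
    then have "cls g \<in> points X" by (auto simp: points)
    then show "T (cls (\<lambda>w. f w + g w)) = T (cls f) + T (cls g)"
      using T f f' g by (auto simp: bounded_ops_def add_cls[symmetric])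
  qed
  then show "\<exists>K. L1_operator smul M (\<lambda>f. T (cls f)) K" ..
next
  assume "\<exists>K. L1_operator smul M (\<lambda>f. T (cls f)) K"
  then obtain K where "L1_operator smul M (\<lambda>f. T (cls f)) K" ..
  then interpret L1_operator smul M "\<lambda>f. T (cls f)" K .
  show "T \<in> bounded_ops X smul"
    unfolding bounded_ops_def points
    using op_bound by (auto simp: add_cls smult_cls nrm_cls op_add op_scale)
qed

lemma bounded_op_op_norm:
  assumes "T \<in> bounded_ops X smul"
  shows "L1_operator smul M (\<lambda>f. T (cls f)) (op_norm X T)"
proof -
  obtain K where "L1_operator smul M (\<lambda>f. T (cls f)) K" using assms bounded_op_iff by blast
  then interpret L1_operator smul M "\<lambda>f. T (cls f)" K .
  show ?thesis
  proof (rule L1_operator_rebound)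
    fix f :: "'a \<Rightarrow> 'k" assume f: "integrable M f"
    let ?r = "L1norm M f"
    show "norm (T (cls f)) \<le> op_norm X T * ?r"
    proof (cases "?r = 0")
      case True
      then show ?thesis using op_bound[OF f] by simp
    next
      case False
      then have r: "?r > 0" by (simp add: less_le)
      have "norm (T (cls (\<lambda>w. inverse ?r *\<^sub>R f w))) \<le> op_norm X T"
        by (rule op_norm_ge[OF op_bound]) (use f r in auto)
      then show ?thesis using r by (simp add: op_scaleR[OF f] field_simps)
    qed
  qed
qed

text \<open>Operators given on functions descend to the points of \<open>X\<close>: a point is evaluated at any of its
  representatives.\<close>

lemma lift_operator:
  assumes "L1_operator smul M \<tau> K"
  obtains S where "S \<in> bounded_ops X smul" "\<And>f. integrable M f \<Longrightarrow> S (cls f) = \<tau> f"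
proof -
  interpret L1_operator smul M \<tau> K by fact
  have S: "\<tau> (rep (cls f)) = \<tau> f" if "integrable M f" for f
    using rep_cls[OF that] that by (intro op_cong_AE cls_eq_AE)
  have "L1_operator smul M (\<lambda>f. \<tau> (rep (cls f))) K"
    by unfold_locales (auto simp: S op_add op_scale intro: op_bound)
  then have "(\<lambda>z. \<tau> (rep z)) \<in> bounded_ops X smul" using bounded_op_iff by blast
  then show ?thesis using S that by blast
qed

end

section \<open>Uniformly convex targets\<close>

text \<open>One of the two vectors may lie in the ball: if the sum is long, the vector is almost of norm one
  and normalizing it moves it by little.\<close>

lemma uniformly_convex_ball:
  assumes uc: "uniformly_convex TYPE('y::real_normed_vector)" and "\<epsilon> > 0"
  obtains \<delta> where "0 < \<delta>" "\<delta> < 1"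
    "\<And>u y :: 'y. norm u \<le> 1 \<Longrightarrow> norm y = 1 \<Longrightarrow> norm (u + y) > 2 - 2 * \<delta> \<Longrightarrow> norm (u - y) < \<epsilon>"
proof -
  obtain d where d: "0 < d" "d < 1"
    "\<And>y1 y2 :: 'y. norm y1 = 1 \<Longrightarrow> norm y2 = 1 \<Longrightarrow> norm (y1 + y2) / 2 > 1 - d \<Longrightarrow> norm (y1 - y2) < \<epsilon> / 2"
    using uc[unfolded uniformly_convex_def, rule_format, of "\<epsilon> / 2"] \<open>\<epsilon> > 0\<close> by auto
  define \<delta> where "\<delta> = min (d / 2) (\<epsilon> / 4)"
  have \<delta>: "0 < \<delta>" "\<delta> \<le> d / 2" "\<delta> \<le> \<epsilon> / 4" using d \<open>\<epsilon> > 0\<close> by (auto simp: \<delta>_def)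
  show ?thesis
  proof
    show "0 < \<delta>" "\<delta> < 1" using \<delta> d by auto
    fix u y :: 'y assume u: "norm u \<le> 1" and y: "norm y = 1" and uy: "norm (u + y) > 2 - 2 * \<delta>"
    have nu: "norm u > 1 - 2 * \<delta>" using norm_triangle_ineq[of u y] uy y by linarith
    then have u0: "u \<noteq> 0" using \<delta> d by auto
    define v where "v = u /\<^sub>R norm u"
    have v: "norm v = 1" using u0 by (simp add: v_def)
    have "u - v = (1 - inverse (norm u)) *\<^sub>R u" by (simp add: v_def algebra_simps)
    then have "norm (u - v) = \<bar>(1 - inverse (norm u)) * norm u\<bar>" by (simp add: abs_mult)
    also have "\<dots> = 1 - norm u" using u u0 by (simp add: algebra_simps)
    finally have uv: "norm (u - v) = 1 - norm u" .
    have "norm (u + y) \<le> norm (u - v) + norm (v + y)"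
      using norm_triangle_ineq[of "u - v" "v + y"] by simp
    then have "norm (v + y) / 2 > 1 - d" using uv uy nu \<delta> by linarith
    then have "norm (v - y) < \<epsilon> / 2" using d(3) v y by blast
    moreover have "norm (u - y) \<le> norm (u - v) + norm (v - y)"
      using norm_triangle_ineq[of "u - v" "v - y"] by simp
    ultimately show "norm (u - y) < \<epsilon>" using uv nu \<delta> by linarith
  qed
qed

text \<open>Sets are added greedily, each one with at least half of the largest measure still available. If a
  set \<open>E\<close> with \<open>P E\<close> avoids all of them, every step has gained at least half of the measure of \<open>E\<close>,
  which a finite measure allows only when that is zero.\<close>

lemma exhaustion:
  assumes "finite_measure N"
    and empty: "P {}"
    and disj: "\<And>C D. C \<in> sets N \<Longrightarrow> D \<in> sets N \<Longrightarrow> P C \<Longrightarrow> P D \<Longrightarrow> C \<inter> D = {} \<Longrightarrow> P (C \<union> D)"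
    and incr: "\<And>C :: nat \<Rightarrow> 'a set. range C \<subseteq> sets N \<Longrightarrow> incseq C \<Longrightarrow> (\<And>n. P (C n)) \<Longrightarrow> P (\<Union>n. C n)"
  obtains B where "B \<in> sets N" "P B"
    "\<And>E. E \<in> sets N \<Longrightarrow> E \<inter> B = {} \<Longrightarrow> P E \<Longrightarrow> measure N E = 0"
proof -
  interpret finite_measure N by fact
  let ?Q = "\<lambda>C E. E \<in> sets N \<and> P E \<and> E \<inter> C = {}"
  have step: "\<exists>E. ?Q C E \<and> (\<forall>E'. ?Q C E' \<longrightarrow> measure N E' \<le> 2 * measure N E)" for C
  proof -
    let ?s = "SUP E\<in>{E. ?Q C E}. measure N E"
    have bdd: "bdd_above (measure N ` {E. ?Q C E})"
      by (intro bdd_aboveI[of _ "measure N (space N)"]) (auto intro: bounded_measure)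
    have ne: "{E. ?Q C E} \<noteq> {}" using empty by auto
    have up: "measure N E \<le> ?s" if "?Q C E" for E
      using that bdd by (intro cSUP_upper) auto
    show ?thesis
    proof (cases "?s > 0")
      case True
      then have "?s / 2 < ?s" by simp
      then obtain E where "?Q C E" "?s / 2 < measure N E"
        using less_cSUP_iff[OF ne bdd] by blast
      moreover have "measure N E' \<le> 2 * measure N E" if "?Q C E'" for E'
        using up[OF that] \<open>?s / 2 < measure N E\<close> by linarith
      ultimately show ?thesis by blast
    next
      case False
      then have "measure N E' \<le> 2 * measure N {}" if "?Q C E'" for E'
        using up[OF that] by simp
      moreover have "?Q C {}" using empty by simp
      ultimately show ?thesis by blast
    qed
  qed
  then obtain pick where pick: "\<And>C. ?Q C (pick C)"
    and big: "\<And>C E'. ?Q C E' \<Longrightarrow> measure N E' \<le> 2 * measure N (pick C)" by metis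
  define C where "C = rec_nat {} (\<lambda>_ D. D \<union> pick D)"
  have C0: "C 0 = {}" and CS: "C (Suc n) = C n \<union> pick (C n)" for n by (simp_all add: C_def)
  have C: "C n \<in> sets N \<and> P (C n)" for n
  proof (induction n)
    case 0 then show ?case using empty by (simp add: C0)
  next
    case (Suc n) then show ?case using pick[of "C n"] disj[of "C n" "pick (C n)"] by (auto simp: CS)
  qed
  have inc: "incseq C" by (intro incseq_SucI) (auto simp: CS)
  have meas: "measure N (C (Suc n)) = measure N (C n) + measure N (pick (C n))" for n
    unfolding CS using C pick by (intro finite_measure_Union) auto
  show ?thesis
  proof
    show "(\<Union>n. C n) \<in> sets N" using C by auto
    show "P (\<Union>n. C n)" using C inc by (intro incr) auto
    fix E assume E: "E \<in> sets N" "E \<inter> (\<Union>n. C n) = {}" "P E"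
    have "measure N E \<le> 2 * measure N (pick (C n))" for n
      using E by (intro big) auto
    then have "real n * measure N E \<le> 2 * measure N (C n)" for n
    proof (induction n)
      case (Suc n)
      from Suc.IH[OF Suc.prems] Suc.prems[of n] show ?case by (simp add: meas algebra_simps)
    qed simp
    then have "real n * measure N E \<le> 2 * measure N (space N)" for n
      using bounded_measure[of "C n"] by (meson mult_left_mono order_trans zero_le_numeral)
    then show "measure N E = 0"
      using measure_nonneg[of N E] by (metis reals_Archimedean3 less_le not_less)
  qed
qed

text \<open>If a contraction almost attains its norm at \<open>f\<close>, it is almost of rank one on a set that carries
  almost all of the mass of \<open>f\<close>. The exhausting set \<open>B\<close> collects the pieces of \<open>f\<close> whose image stays
  away from the direction \<open>y\<close> of \<open>T f\<close>; each piece costs the norm of \<open>T f + y\<close> a proportional amount,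
  so there can be little of them.\<close>

lemma (in L1_operator) almost_rank_one_on_large_set:
  assumes contractive: "K \<le> 1"
    and uc: "\<And>u y :: 'y. norm u \<le> 1 \<Longrightarrow> norm y = 1 \<Longrightarrow> norm (u + y) > 2 - 2 * \<delta> \<Longrightarrow> norm (u - y) < e"
    and f: "integrable M f" "L1norm M f = 1" "norm (\<tau> f) > 1 - \<eta>" "\<eta> < 1"
  obtains A where "A \<in> sets M"
    "2 * \<delta> * (1 - L1norm M (\<lambda>w. indicator A w *\<^sub>R f w)) \<le> \<eta>"
    "\<And>\<phi>. integrable M \<phi> \<Longrightarrow> (\<And>w. w \<notin> A \<Longrightarrow> \<phi> w = 0) \<Longrightarrow>
      norm (\<tau> \<phi> - smul (sign_integral M f \<phi>) (\<tau> f /\<^sub>R norm (\<tau> f))) \<le> e * L1norm M \<phi>"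
proof -
  define y where "y = \<tau> f /\<^sub>R norm (\<tau> f)"
  have "\<tau> f \<noteq> 0" using f by auto
  then have y: "norm y = 1" and f_y: "\<tau> f = norm (\<tau> f) *\<^sub>R y" by (auto simp: y_def)
  have bound: "norm (\<tau> \<phi>) \<le> L1norm M \<phi>" if "integrable M \<phi>" for \<phi>
    using op_bound[OF that] mult_right_mono[OF contractive, of "L1norm M \<phi>"] by simp
  have [measurable]: "f \<in> borel_measurable M" using f by auto
  define N where "N = density M (\<lambda>w. ennreal (norm (f w)))"
  have setsN[simp]: "sets N = sets M" and spaceN[simp]: "space N = space M" by (auto simp: N_def)
  have int: "integrable M (\<lambda>w. indicator E w *\<^sub>R f w)" if "E \<in> sets M" for E
    by (rule integrable_mult_indicator[OF that f(1)])
  have emN: "emeasure N E = ennreal (L1norm M (\<lambda>w. indicator E w *\<^sub>R f w))" if E: "E \<in> sets M" for E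
  proof -
    have "emeasure N E = (\<integral>\<^sup>+w. ennreal (norm (f w)) * indicator E w \<partial>M)"
      unfolding N_def using E by (intro emeasure_density) auto
    also have "\<dots> = (\<integral>\<^sup>+w. ennreal (norm (indicator E w *\<^sub>R f w)) \<partial>M)"
      by (intro nn_integral_cong) (auto simp: indicator_def)
    also have "\<dots> = ennreal (L1norm M (\<lambda>w. indicator E w *\<^sub>R f w))"
      using integrable_norm[OF int[OF E]] by (intro nn_integral_eq_integral) auto
    finally show ?thesis .
  qed
  then have N: "measure N E = L1norm M (\<lambda>w. indicator E w *\<^sub>R f w)" if "E \<in> sets M" for E
    using that by (simp add: measure_def)
  have finN: "finite_measure N" by (intro finite_measureI) (simp add: emN)
  then interpret N: finite_measure N .
  \<comment> \<open>The negation of \<open>P E\<close>, divided by the mass of \<open>E\<close>, is the hypothesis of \<open>uc\<close> for the average of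
    \<open>T f\<close> over \<open>E\<close>. A null set satisfies \<open>P\<close>, hence a set violating \<open>P\<close> has positive mass.\<close>
  define P where "P E \<longleftrightarrow>
    norm (\<tau> (\<lambda>w. indicator E w *\<^sub>R f w) + measure N E *\<^sub>R y) \<le> (2 - 2 * \<delta>) * measure N E" for E
  obtain B where B: "B \<in> sets N" "P B"
    and max: "\<And>E. E \<in> sets N \<Longrightarrow> E \<inter> B = {} \<Longrightarrow> P E \<Longrightarrow> measure N E = 0"
  proof (rule exhaustion[OF finN, of P])
    show "P {}" by (simp add: P_def op_zero)
    fix C D assume CD: "C \<in> sets N" "D \<in> sets N" "P C" "P D" "C \<inter> D = {}"
    have m: "measure N (C \<union> D) = measure N C + measure N D"
      using CD by (intro N.finite_measure_Union) auto
    have "\<tau> (\<lambda>w. indicator (C \<union> D) w *\<^sub>R f w)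
        = \<tau> (\<lambda>w. indicator C w *\<^sub>R f w + indicator D w *\<^sub>R f w)"
      using CD(5) by (intro arg_cong[of _ _ \<tau>] ext) (auto simp: indicator_def)
    also have "\<dots> = \<tau> (\<lambda>w. indicator C w *\<^sub>R f w) + \<tau> (\<lambda>w. indicator D w *\<^sub>R f w)"
      using CD int by (intro op_add) auto
    finally have "\<tau> (\<lambda>w. indicator (C \<union> D) w *\<^sub>R f w) + measure N (C \<union> D) *\<^sub>R y
      = (\<tau> (\<lambda>w. indicator C w *\<^sub>R f w) + measure N C *\<^sub>R y)
      + (\<tau> (\<lambda>w. indicator D w *\<^sub>R f w) + measure N D *\<^sub>R y)"
      by (simp add: m scaleR_left_distrib)
    then show "P (C \<union> D)" using CD(3,4) m norm_triangle_mono by (fastforce simp: P_def distrib_left)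
  next
    fix C :: "nat \<Rightarrow> 'a set" assume C: "range C \<subseteq> sets N" "incseq C" "\<And>n. P (C n)"
    have C': "C n \<in> sets M" for n using C(1) by auto
    have m: "(\<lambda>n. measure N (C n)) \<longlonglongrightarrow> measure N (\<Union>n. C n)"
      using C by (intro N.finite_Lim_measure_incseq)
    have "(\<lambda>n. \<tau> (\<lambda>w. indicator (C n) w *\<^sub>R f w)) \<longlonglongrightarrow> \<tau> (\<lambda>w. indicator (\<Union>n. C n) w *\<^sub>R f w)"
    proof (rule op_dominated_convergence[where h="\<lambda>w. norm (f w)"])
      show "AE w in M. (\<lambda>n. indicator (C n) w *\<^sub>R f w) \<longlonglongrightarrow> indicator (\<Union>n. C n) w *\<^sub>R f w"
        by (intro AE_I2 tendsto_scaleR LIMSEQ_indicator_incseq C(2) tendsto_const)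
      show "AE w in M. norm (indicator (C n) w *\<^sub>R f w) \<le> norm (f w)" for n
        by (auto simp: indicator_def)
      have "(\<Union>n. C n) \<in> sets M" using C' by auto
      then show "(\<lambda>w. indicator (\<Union>n. C n) w *\<^sub>R f w) \<in> borel_measurable M" 
        using int by (intro borel_measurable_integrable)
      show "(\<lambda>w. indicator (C n) w *\<^sub>R f w) \<in> borel_measurable M" for n
        using int[OF C'] by (rule borel_measurable_integrable)
    qed (use f in auto)
    with m show "P (\<Union>n. C n)"
      unfolding P_def using C(3)[unfolded P_def]
      by (intro LIMSEQ_le[where X="\<lambda>n. norm (\<tau> (\<lambda>w. indicator (C n) w *\<^sub>R f w) + measure N (C n) *\<^sub>R y)"
            and Y="\<lambda>n. (2 - 2 * \<delta>) * measure N (C n)"]) (auto intro!: tendsto_intros)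
  qed (rule that)
  have B': "B \<in> sets M" using B by simp
  define A where "A = {w \<in> space M. f w \<noteq> 0} - B"
  have A: "A \<in> sets M" using B' by (auto simp: A_def)
  have mA: "L1norm M (\<lambda>w. indicator A w *\<^sub>R f w) = 1 - measure N B"
  proof -
    have "L1norm M (\<lambda>w. indicator A w *\<^sub>R f w) = L1norm M (\<lambda>w. indicator (space M - B) w *\<^sub>R f w)"
      by (intro Bochner_Integration.integral_cong) (auto simp: A_def indicator_def)
    then show ?thesis using L1norm_split[OF B' f(1)] f(2) N[OF B'] by simp
  qed
  show ?thesis
  proof
    show "A \<in> sets M" by fact
    show "2 * \<delta> * (1 - L1norm M (\<lambda>w. indicator A w *\<^sub>R f w)) \<le> \<eta>"
    proof -
      let ?b = "measure N B" and ?fB = "\<tau> (\<lambda>w. indicator B w *\<^sub>R f w)"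
        and ?fC = "\<tau> (\<lambda>w. indicator (space M - B) w *\<^sub>R f w)"
      have b: "norm ?fC \<le> 1 - ?b"
        using L1norm_split[OF B' f(1)] f(2) N[OF B'] bound[OF integrable_restrict_minus(2)[OF B' f(1)]]
        by simp
      then have "?b \<le> 1" using norm_ge_zero[of ?fC] by linarith
      have "\<tau> f + y = (norm (\<tau> f) + 1) *\<^sub>R y" by (subst f_y) (simp add: scaleR_left_distrib)
      then have "norm (\<tau> f + y) = norm (\<tau> f) + 1" using y by simp
      moreover have "\<tau> f + y = (?fB + ?b *\<^sub>R y) + (?fC + (1 - ?b) *\<^sub>R y)"
        unfolding op_split[OF B' f(1)] by (simp add: algebra_simps)
      moreover have "norm (?fB + ?b *\<^sub>R y) \<le> (2 - 2 * \<delta>) * ?b" using B(2) by (simp add: P_def)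
      moreover have "norm (?fC + (1 - ?b) *\<^sub>R y) \<le> (1 - ?b) + (1 - ?b)"
        using b y \<open>?b \<le> 1\<close> by (intro norm_triangle_mono) auto
      ultimately have "norm (\<tau> f) + 1 \<le> (2 - 2 * \<delta>) * ?b + (2 - 2 * ?b)"
        using norm_triangle_ineq[of "?fB + ?b *\<^sub>R y" "?fC + (1 - ?b) *\<^sub>R y"] by simp
      then show ?thesis using f(3) unfolding mA by (simp add: algebra_simps)
    qed
    fix \<phi> :: "'a \<Rightarrow> 'k" assume \<phi>: "integrable M \<phi>" "\<And>w. w \<notin> A \<Longrightarrow> \<phi> w = 0"
    \<comment> \<open>The deviation from rank one is itself an operator, so it suffices to bound it on sets.\<close>
    have "L1_operator smul M (\<lambda>\<phi>. \<tau> \<phi> + (- 1) *\<^sub>R smul (sign_integral M f \<phi>) y) (K + \<bar>- 1\<bar> * norm y)"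
      by (intro L1_operator_plus L1_operator_scaleR sign_operator L1_operator_axioms) auto
    then interpret D: L1_operator smul M "\<lambda>\<phi>. \<tau> \<phi> - smul (sign_integral M f \<phi>) y" "K + \<bar>- 1\<bar> * norm y"
      by simp
    have "norm (\<tau> \<phi> - smul (sign_integral M f \<phi>) y) \<le> e * L1norm M \<phi>"
    proof (rule D.bound_from_sets[OF int[OF A] _ \<phi>(1)])
      show "\<phi> w = 0" if "indicator A w *\<^sub>R f w = 0" for w
        using that \<phi>(2)[of w] by (cases "w \<in> A") (auto simp: A_def)
      fix E assume "E \<in> sets M"
      define F where "F = E \<inter> A"
      have F: "F \<in> sets M" "F \<inter> B = {}" using \<open>E \<in> sets M\<close> A by (auto simp: F_def A_def)
      have EF: "indicator E w *\<^sub>R indicator A w *\<^sub>R f w = indicator F w *\<^sub>R f w" for w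
        by (auto simp: F_def indicator_def)
      let ?t = "\<tau> (\<lambda>w. indicator F w *\<^sub>R f w)" and ?n = "measure N F"
      have tn: "norm ?t \<le> ?n" using bound[OF int[OF F(1)]] N[OF F(1)] by simp
      have "norm (?t - ?n *\<^sub>R y) \<le> e * ?n"
      proof (cases "P F")
        case True
        then have "?n = 0" using max F by simp
        then show ?thesis using tn by simp
      next
        case False
        then have "?n \<noteq> 0" using tn by (auto simp: P_def)
        then have n: "?n > 0" by (simp add: zero_less_measure_iff)
        have "(2 - 2 * \<delta>) * ?n < norm (?t + ?n *\<^sub>R y)" using False by (simp add: P_def)
        also have "?t + ?n *\<^sub>R y = ?n *\<^sub>R (?t /\<^sub>R ?n + y)" using n by (simp add: algebra_simps)
        finally have "2 - 2 * \<delta> < norm (?t /\<^sub>R ?n + y)" using n by simp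
        moreover have "norm (?t /\<^sub>R ?n) \<le> 1" using tn n by (simp add: field_simps)
        ultimately have "norm (?t /\<^sub>R ?n - y) < e" using uc y by blast
        moreover have "?t - ?n *\<^sub>R y = ?n *\<^sub>R (?t /\<^sub>R ?n - y)" using n by (simp add: algebra_simps)
        ultimately show ?thesis using n by simp
      qed
      then show "norm (\<tau> (\<lambda>w. indicator E w *\<^sub>R indicator A w *\<^sub>R f w)
            - smul (sign_integral M f (\<lambda>w. indicator E w *\<^sub>R indicator A w *\<^sub>R f w)) y)
          \<le> e * L1norm M (\<lambda>w. indicator E w *\<^sub>R indicator A w *\<^sub>R f w)"
        by (simp only: EF sign_integral_self[OF F(1) f(1)] N[OF F(1), symmetric] smul_of_real)
    qed
    then show "norm (\<tau> \<phi> - smul (sign_integral M f \<phi>) (\<tau> f /\<^sub>R norm (\<tau> f))) \<le> e * L1norm M \<phi>"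
      by (simp add: y_def)
  qed
qed

context L1_model_banach
begin

text \<open>The approximating operator is exactly of rank one on the set \<open>A\<close> supplied by
  \<open>almost_rank_one_on_large_set\<close>, and its norm-attaining point is the normalized restriction of the given
  function to \<open>A\<close>.\<close>

theorem uniformly_convex_imp_BPBp_RSE:
  assumes uc: "uniformly_convex TYPE('y)"
  shows "BPBp_RSE X smul"
  unfolding BPBp_RSE_def
proof (intro allI impI)
  fix \<epsilon> :: real assume "\<epsilon> > 0"
  define e where "e = min \<epsilon> 1 / 2"
  have e: "0 < e" "e < 1" "e < \<epsilon>" using \<open>\<epsilon> > 0\<close> by (auto simp: e_def)
  obtain \<delta> where \<delta>: "0 < \<delta>" "\<delta> < 1"
    and conv: "\<And>u y :: 'y. norm u \<le> 1 \<Longrightarrow> norm y = 1 \<Longrightarrow> norm (u + y) > 2 - 2 * \<delta> \<Longrightarrow> norm (u - y) < e"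
    using uniformly_convex_ball[OF uc e(1)] by metis
  \<comment> \<open>The mass of \<open>f\<close> outside \<open>A\<close> is at most \<open>\<eta> / (2 \<delta>)\<close>, hence at most \<open>e / 2\<close>.\<close>
  define \<eta> where "\<eta> = \<delta> * e"
  have \<eta>: "0 < \<eta>" "\<eta> < e" using \<delta> e by (auto simp: \<eta>_def)
  show "\<exists>\<eta>>0. \<eta> < \<epsilon> \<and>
     (\<forall>T\<in>bounded_ops X smul. op_norm X T = 1 \<longrightarrow>
       (\<forall>x\<in>unit_sphere X. norm (T x) > 1 - \<eta> \<longrightarrow>
         (\<exists>S\<in>RSE X smul. \<exists>x0\<in>unit_sphere X.
            op_norm X S = 1 \<and> norm (S x0) = 1 \<and>
            op_norm X (\<lambda>z. S z - T z) < \<epsilon> \<and> nrm X (minus_in X x x0) < \<epsilon>)))"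
  proof (intro exI[of _ \<eta>] conjI ballI impI)
    show "0 < \<eta>" "\<eta> < \<epsilon>" using \<eta> e by auto
    fix T x assume T: "T \<in> bounded_ops X smul" "op_norm X T = 1"
      and x: "x \<in> unit_sphere X" "norm (T x) > 1 - \<eta>"
    define \<tau> where "\<tau> = (\<lambda>f. T (cls f))"
    interpret L1_operator smul M \<tau> 1
      using bounded_op_op_norm[OF T(1)] T(2) by (simp add: \<tau>_def)
    obtain f where f: "x = cls f" "integrable M f" "L1norm M f = 1"
      using x(1) by (auto simp: unit_sphere_cls)
    have \<tau>f: "norm (\<tau> f) > 1 - \<eta>" using x(2) f by (simp add: \<tau>_def)
    define y where "y = \<tau> f /\<^sub>R norm (\<tau> f)"
    have "\<tau> f \<noteq> 0" using \<tau>f \<eta> e by auto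
    then have y: "norm y = 1" by (simp add: y_def)
    obtain A where A: "A \<in> sets M"
      and mass: "2 * \<delta> * (1 - L1norm M (\<lambda>w. indicator A w *\<^sub>R f w)) \<le> \<eta>"
      and close: "\<And>\<phi>. integrable M \<phi> \<Longrightarrow> (\<And>w. w \<notin> A \<Longrightarrow> \<phi> w = 0) \<Longrightarrow>
        norm (\<tau> \<phi> - smul (sign_integral M f \<phi>) y) \<le> e * L1norm M \<phi>"
      unfolding y_def
      by (rule almost_rank_one_on_large_set[OF _ conv f(2,3) \<tau>f]) (use \<eta> e in auto)
    let ?on = "\<lambda>\<phi> w. indicator A w *\<^sub>R \<phi> w" and ?off = "\<lambda>\<phi> w. indicator (space M - A) w *\<^sub>R \<phi> w"
    have fm: "f \<in> borel_measurable M" using f(2) by auto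
    note on = integrable_restrict_minus(1)[OF A] and off = integrable_restrict_minus(2)[OF A]
    \<comment> \<open>Shrinking by \<open>1 - e\<close> off \<open>A\<close> makes mass outside \<open>A\<close> strictly unprofitable, which is what forces
      norming sequences onto \<open>A\<close>; it changes \<open>T\<close> by at most \<open>e\<close>.\<close>
    define \<sigma> where "\<sigma> \<phi> = smul (sign_integral M f (?on \<phi>)) y + (1 - e) *\<^sub>R \<tau> (?off \<phi>)" for \<phi>
    have \<sigma>_bound: "norm (\<sigma> \<phi>) \<le> norm (sign_integral M f (?on \<phi>)) + (1 - e) * L1norm M (?off \<phi>)"
      if "integrable M \<phi>" for \<phi>
    proof -
      have "norm (\<tau> (?off \<phi>)) \<le> L1norm M (?off \<phi>)" using op_bound[OF off[OF that]] by simp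
      then have "(1 - e) * norm (\<tau> (?off \<phi>)) \<le> (1 - e) * L1norm M (?off \<phi>)"
        using e by (intro mult_left_mono) auto
      then show ?thesis
        unfolding \<sigma>_def using e y by (intro norm_triangle_mono) (auto simp: norm_smul)
    qed
    have \<sigma>_bound': "norm (\<sigma> \<phi>) \<le> L1norm M \<phi> - e * L1norm M (?off \<phi>)" if "integrable M \<phi>" for \<phi>
      using \<sigma>_bound[OF that] norm_sign_integral_le[OF fm on[OF that]] L1norm_split[OF A that]
      by (simp add: algebra_simps)
    have "L1_operator smul M \<sigma> (norm y + \<bar>1 - e\<bar> * 1)"
      unfolding \<sigma>_def
    proof (intro L1_operator_plus L1_operator_scaleR L1_operator_restrict)
      interpret s: L1_operator smul M "\<lambda>\<phi>. smul (sign_integral M f \<phi>) y" "norm y"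
        by (rule sign_operator[OF fm])
      show "L1_operator smul M (\<lambda>\<phi>. smul (sign_integral M f (?on \<phi>)) y) (norm y)"
        by (rule s.L1_operator_restrict[OF A]) simp
    qed (use A in auto)
    then obtain S where S: "S \<in> bounded_ops X smul" "\<And>\<phi>. integrable M \<phi> \<Longrightarrow> S (cls \<phi>) = \<sigma> \<phi>"
      using lift_operator by blast
    define a where "a = L1norm M (?on f)"
    have "2 * \<delta> * (1 - a) \<le> \<delta> * e" using mass by (simp add: a_def \<eta>_def)
    then have "\<delta> * (2 * (1 - a)) \<le> \<delta> * e" by (simp add: algebra_simps)
    then have a: "2 * (1 - a) \<le> e" using \<delta> by simp
    have "2 * (1 - a) < 1" using a e(2) by (rule order_le_less_trans)
    then have a0: "a > 0" by simp
    have fa: "L1norm M (?off f) = 1 - a" using L1norm_split[OF A f(2)] f(3) by (simp add: a_def)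
    define g where "g = (\<lambda>w. inverse a *\<^sub>R ?on f w)"
    have g: "integrable M g" unfolding g_def by (intro integrable_scaleR_right on f(2))
    have g1: "L1norm M g = 1"
      unfolding g_def L1norm_scaleR a_def[symmetric] using a0 by simp
    have ong: "?on g = g" "?off g = (\<lambda>w. 0)" by (auto simp: g_def indicator_def)
    have "sign_integral M f g = 1"
      unfolding g_def sign_integral_scaleR sign_integral_self[OF A f(2)] a_def[symmetric]
      using a0 by (simp add: scaleR_conv_of_real)
    then have Sg: "S (cls g) = y" using S(2)[OF g] by (simp add: \<sigma>_def ong op_zero)
    have S_bound: "norm (S (cls \<phi>)) \<le> 1 * L1norm M \<phi>" if "integrable M \<phi>" for \<phi>
    proof -
      have "0 \<le> e * L1norm M (?off \<phi>)" using e by (intro mult_nonneg_nonneg) auto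
      then show ?thesis unfolding S(2)[OF that] using \<sigma>_bound'[OF that] by linarith
    qed
    have S1: "op_norm X S = 1"
    proof (rule antisym)
      show "op_norm X S \<le> 1" using S_bound by (intro op_norm_le) force
      show "1 \<le> op_norm X S" using op_norm_ge[OF S_bound g] g1 Sg y by simp
    qed
    have "S \<in> RSE X smul"
      unfolding RSE_def
    proof (intro CollectI conjI bexI[of _ "cls g"] allI impI S(1))
      show "cls g \<in> unit_sphere X" using g g1 by (auto simp: unit_sphere_cls)
      fix z :: "nat \<Rightarrow> 'x"
      assume z: "(\<forall>n. z n \<in> unit_ball X) \<and> (\<lambda>n. norm (S (z n))) \<longlonglongrightarrow> op_norm X S"
      then have "\<forall>n. \<exists>\<phi>. z n = cls \<phi> \<and> integrable M \<phi> \<and> L1norm M \<phi> \<le> 1"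
        by (auto simp: unit_ball_cls)
      then obtain \<phi> where \<phi>: "z n = cls (\<phi> n)" "integrable M (\<phi> n)" "L1norm M (\<phi> n) \<le> 1" for n
        by metis
      define c where "c n = sign_integral M f (?on (\<phi> n))" for n
      define q where "q n = L1norm M (?off (\<phi> n))" for n
      have lim: "(\<lambda>n. norm (\<sigma> (\<phi> n))) \<longlonglongrightarrow> 1" using z by (simp add: S1 \<phi> S(2))
      have q0: "0 \<le> q n" for n by (simp add: q_def)
      have upper: "norm (\<sigma> (\<phi> n)) \<le> 1 - e * q n" for n
        using \<sigma>_bound'[OF \<phi>(2)[of n]] \<phi>(3)[of n] by (simp add: q_def)
      have "(\<lambda>n. (1 - norm (\<sigma> (\<phi> n))) / e) \<longlonglongrightarrow> (1 - 1) / e"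
        using e by (intro tendsto_intros lim) auto
      then have "(\<lambda>n. (1 - norm (\<sigma> (\<phi> n))) / e) \<longlonglongrightarrow> 0" by simp
      moreover have "norm (q n) \<le> (1 - norm (\<sigma> (\<phi> n))) / e" for n
        using upper[of n] q0[of n] e by (simp add: field_simps)
      ultimately have q: "q \<longlonglongrightarrow> 0" by (intro Lim_null_comparison[of q]) auto
      have c1: "norm (c n) \<le> 1" for n
        using norm_sign_integral_le[OF fm on[OF \<phi>(2)[of n]]] L1norm_split[OF A \<phi>(2)[of n]]
          \<phi>(3)[of n] q0[of n] unfolding c_def q_def by linarith
      have lower: "norm (\<sigma> (\<phi> n)) - q n \<le> norm (c n)" for n
      proof -
        have "(1 - e) * q n \<le> 1 * q n" using e q0 by (intro mult_right_mono) auto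
        then show ?thesis using \<sigma>_bound[OF \<phi>(2)[of n]] unfolding c_def q_def by linarith
      qed
      have "(\<lambda>n. norm (c n)) \<longlonglongrightarrow> 1"
      proof (rule tendsto_sandwich)
        show "(\<lambda>n. norm (\<sigma> (\<phi> n)) - q n) \<longlonglongrightarrow> 1" using tendsto_diff[OF lim q] by simp
        show "(\<lambda>n. 1 :: real) \<longlonglongrightarrow> 1" by simp
      qed (use lower c1 in auto)
      obtain s :: "nat \<Rightarrow> nat" and \<theta> where s: "strict_mono s" "(\<lambda>n. c (s n)) \<longlonglongrightarrow> \<theta>"
        by (rule scalar_bounded_subsequence[of c, OF c1])
      have "(\<lambda>n. norm (c (s n))) \<longlonglongrightarrow> 1"
        using LIMSEQ_subseq_LIMSEQ[OF \<open>(\<lambda>n. norm (c n)) \<longlonglongrightarrow> 1\<close> s(1)] by (simp add: o_def)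
      then have \<theta>: "norm \<theta> = 1" by (rule LIMSEQ_unique[OF tendsto_norm[OF s(2)]])
      have "(\<lambda>n. norm (c (s n) - \<theta>) + q (s n)) \<longlonglongrightarrow> 0 + 0"
        using LIMSEQ_subseq_LIMSEQ[OF q s(1)]
        by (intro tendsto_add tendsto_norm_zero LIM_zero s(2)) (simp add: o_def)
      then have gap: "(\<lambda>n. norm (c (s n) - \<theta>) + q (s n)) \<longlonglongrightarrow> 0" by simp
      have est: "norm (S (z n) - smul \<theta> y) \<le> norm (c n - \<theta>) + q n" for n
      proof -
        have "S (z n) - smul \<theta> y = smul (c n - \<theta>) y + (1 - e) *\<^sub>R \<tau> (?off (\<phi> n))"
          by (simp add: \<phi> S(2) \<sigma>_def c_def scale_left_diff_distrib)
        moreover have "norm ((1 - e) *\<^sub>R \<tau> (?off (\<phi> n))) \<le> 1 * q n"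
          unfolding norm_scaleR using e op_bound[OF off[OF \<phi>(2)[of n]]] q0
          by (intro mult_mono) (auto simp: q_def)
        ultimately show ?thesis using y norm_triangle_mono[of "smul (c n - \<theta>) y" "norm (c n - \<theta>)"]
          by (simp add: norm_smul)
      qed
      have "(\<lambda>n. S (z (s n)) - smul \<theta> y) \<longlonglongrightarrow> 0"
        by (rule Lim_null_comparison[OF always_eventually[OF allI] gap]) (rule est)
      then have "(\<lambda>n. S (z (s n))) \<longlonglongrightarrow> smul \<theta> (S (cls g))" by (simp add: LIM_zero_iff Sg)
      with s(1) \<theta> show "\<exists>(\<sigma> :: nat \<Rightarrow> nat) \<theta>. strict_mono \<sigma> \<and> norm \<theta> = 1 \<and>
          (\<lambda>n. S (z (\<sigma> n))) \<longlonglongrightarrow> smul \<theta> (S (cls g))"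
        by (intro exI conjI)
    qed
    moreover have "op_norm X (\<lambda>z. S z - T z) < \<epsilon>"
    proof -
      have "norm (S (cls \<phi>) - T (cls \<phi>)) \<le> e" if \<phi>: "integrable M \<phi>" "L1norm M \<phi> \<le> 1" for \<phi>
      proof -
        have "S (cls \<phi>) - T (cls \<phi>)
            = - (\<tau> (?on \<phi>) - smul (sign_integral M f (?on \<phi>)) y) + (- e) *\<^sub>R \<tau> (?off \<phi>)"
          using op_split[OF A \<phi>(1)] by (simp add: S(2) \<phi> \<sigma>_def \<tau>_def[symmetric] fun_cong[OF \<tau>_def, symmetric] algebra_simps)
        also have "norm \<dots> \<le> e * L1norm M (?on \<phi>) + e * L1norm M (?off \<phi>)"
        proof (rule norm_triangle_mono)
          show "norm (- (\<tau> (?on \<phi>) - smul (sign_integral M f (?on \<phi>)) y)) \<le> e * L1norm M (?on \<phi>)"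
            unfolding norm_minus_cancel by (rule close[OF on[OF \<phi>(1)]]) simp
          show "norm ((- e) *\<^sub>R \<tau> (?off \<phi>)) \<le> e * L1norm M (?off \<phi>)"
            using op_bound[OF off[OF \<phi>(1)]] e by simp
        qed
        also have "\<dots> = e * L1norm M \<phi>" using L1norm_split[OF A \<phi>(1)] by (simp add: distrib_left)
        also have "\<dots> \<le> e" using \<phi> e by simp
        finally show ?thesis .
      qed
      then have "op_norm X (\<lambda>z. S z - T z) \<le> e" by (rule op_norm_le)
      then show ?thesis using e by simp
    qed
    moreover have "nrm X (minus_in X x (cls g)) < \<epsilon>"
    proof -
      have "nrm X (minus_in X x (cls g)) = L1norm M (\<lambda>w. f w - g w)"
        using f g by (simp add: minus_cls nrm_cls)
      also have "\<dots> = L1norm M (\<lambda>w. ?on (\<lambda>w. f w - g w) w) + L1norm M (\<lambda>w. ?off (\<lambda>w. f w - g w) w)"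
        using f g by (intro L1norm_split[OF A]) auto
      also have "L1norm M (\<lambda>w. ?off (\<lambda>w. f w - g w) w) = 1 - a"
        unfolding fa[symmetric]
        by (intro Bochner_Integration.integral_cong) (auto simp: g_def indicator_def)
      also have "(\<lambda>w. ?on (\<lambda>w. f w - g w) w) = (\<lambda>w. (1 - inverse a) *\<^sub>R ?on f w)"
        by (auto simp: g_def indicator_def algebra_simps)
      also have "L1norm M \<dots> = \<bar>1 - inverse a\<bar> * a"
        unfolding L1norm_scaleR a_def ..
      also have "\<dots> = \<bar>(1 - inverse a) * a\<bar>" using a0 by (simp add: abs_mult)
      also have "\<dots> = \<bar>a - 1\<bar>" using a0 by (simp add: left_diff_distrib)
      also have "\<bar>a - 1\<bar> + (1 - a) < \<epsilon>"
      proof -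
        have "1 - a \<ge> 0" unfolding fa[symmetric] by simp
        then show ?thesis using a e by simp
      qed
      finally show ?thesis .
    qed
    ultimately show "\<exists>S\<in>RSE X smul. \<exists>x0\<in>unit_sphere X.
            op_norm X S = 1 \<and> norm (S x0) = 1 \<and>
            op_norm X (\<lambda>z. S z - T z) < \<epsilon> \<and> nrm X (minus_in X x x0) < \<epsilon>"
      using S1 Sg y g g1 by (intro bexI[of _ S] bexI[of _ "cls g"]) (auto simp: unit_sphere_cls)
  qed
qed

end

section \<open>Uniform convexity from the Bishop-Phelps-Bollobas property\<close>

text \<open>For comparing normalized halves: if \<open>f\<close> has norm one half and \<open>g\<close> is close to \<open>f\<close>, both terms on the
  right are small.\<close>

lemma normalized_near_half:
  fixes f g :: "'a \<Rightarrow> 'b::{banach, second_countable_topology}"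
  assumes "integrable M f" "integrable M g" "L1norm M g > 0"
  shows "L1norm M (\<lambda>w. g w /\<^sub>R L1norm M g - 2 *\<^sub>R f w)
    \<le> \<bar>1 - 2 * L1norm M g\<bar> + 2 * L1norm M (\<lambda>w. f w - g w)"
proof -
  let ?p = "L1norm M g"
  have "g w /\<^sub>R ?p - 2 *\<^sub>R f w = (inverse ?p - 2) *\<^sub>R g w + (- 2) *\<^sub>R (f w - g w)" for w
    by (simp add: algebra_simps scaleR_2)
  then have "L1norm M (\<lambda>w. g w /\<^sub>R ?p - 2 *\<^sub>R f w)
      = L1norm M (\<lambda>w. (inverse ?p - 2) *\<^sub>R g w + (- 2) *\<^sub>R (f w - g w))" by (simp only:)
  also have "\<dots> \<le> L1norm M (\<lambda>w. (inverse ?p - 2) *\<^sub>R g w) + L1norm M (\<lambda>w. (- 2) *\<^sub>R (f w - g w))"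
    by (intro L1norm_triangle integrable_scaleR_right Bochner_Integration.integrable_diff assms)
  also have "\<dots> = \<bar>(inverse ?p - 2) * ?p\<bar> + 2 * L1norm M (\<lambda>w. f w - g w)"
    unfolding L1norm_scaleR using assms(3) by (simp add: abs_mult)
  also have "(inverse ?p - 2) * ?p = 1 - 2 * ?p"
    using assms(3) by (simp add: left_diff_distrib)
  finally show ?thesis .
qed

context L1_model_banach
begin

text \<open>The definition of range strong exposure, applied to constant sequences.\<close>

lemma RSE_norm_attaining:
  assumes "S \<in> RSE X smul"
  obtains w where "\<And>f. integrable M f \<Longrightarrow> L1norm M f \<le> 1 \<Longrightarrow> norm (S (cls f)) = op_norm X S \<Longrightarrow>
    \<exists>\<theta>. norm \<theta> = 1 \<and> S (cls f) = smul \<theta> w"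
proof -
  obtain x0 where x0: "\<And>x :: nat \<Rightarrow> 'x. (\<forall>n. x n \<in> unit_ball X) \<and> (\<lambda>n. norm (S (x n))) \<longlonglongrightarrow> op_norm X S \<Longrightarrow>
     (\<exists>(\<sigma> :: nat \<Rightarrow> nat) \<theta>. strict_mono \<sigma> \<and> norm \<theta> = 1 \<and>
        (\<lambda>n. S (x (\<sigma> n))) \<longlonglongrightarrow> smul \<theta> (S x0))"
    using assms unfolding RSE_def by auto
  show ?thesis
  proof
    fix f :: "'a \<Rightarrow> 'k" assume f: "integrable M f" "L1norm M f \<le> 1" "norm (S (cls f)) = op_norm X S"
    have "(\<forall>n. cls f \<in> unit_ball X) \<and> (\<lambda>n::nat. norm (S (cls f))) \<longlonglongrightarrow> op_norm X S"
      using f by (auto simp: unit_ball_cls)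
    from x0[OF this] obtain \<theta> where "norm \<theta> = 1" "(\<lambda>n::nat. S (cls f)) \<longlonglongrightarrow> smul \<theta> (S x0)"
      by auto
    then show "\<exists>\<theta>. norm \<theta> = 1 \<and> S (cls f) = smul \<theta> (S x0)"
      using LIMSEQ_unique tendsto_const by metis
  qed
qed

text \<open>An operator with the required property cannot attain its norm on two disjointly supported pieces
  with different values, so the two values \<open>y1\<close>, \<open>y2\<close> of the operator that it approximates must be
  close.\<close>

theorem BPBp_RSE_imp_uniformly_convex:
  fixes u1 u2 :: "'a \<Rightarrow> 'k"
  assumes bpb: "BPBp_RSE X smul"
    and u1: "integrable M u1" "L1norm M u1 = 1"
    and u2: "integrable M u2" "L1norm M u2 = 1"
    and disjoint: "\<And>w. u1 w = 0 \<or> u2 w = 0"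
  shows "uniformly_convex TYPE('y)"
  unfolding uniformly_convex_def
proof (intro allI impI)
  fix \<epsilon> :: real assume "\<epsilon> > 0"
  \<comment> \<open>Each of \<open>y1\<close>, \<open>y2\<close> is within \<open>5 e\<close> of the common value, and \<open>e < 1 / 2\<close> keeps both pieces of the
    norm-attaining point nonzero.\<close>
  define e where "e = min \<epsilon> 1 / 20"
  have e: "0 < e" "e \<le> 1 / 20" "20 * e \<le> \<epsilon>" using \<open>\<epsilon> > 0\<close> by (auto simp: e_def)
  obtain \<eta> where \<eta>: "0 < \<eta>" and
    BPB: "\<And>T x. T \<in> bounded_ops X smul \<Longrightarrow> op_norm X T = 1 \<Longrightarrow> x \<in> unit_sphere X \<Longrightarrow>
      norm (T x) > 1 - \<eta> \<Longrightarrow> \<exists>S\<in>RSE X smul. \<exists>x0\<in>unit_sphere X.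
            op_norm X S = 1 \<and> norm (S x0) = 1 \<and>
            op_norm X (\<lambda>z. S z - T z) < e \<and> nrm X (minus_in X x x0) < e"
    using bpb[unfolded BPBp_RSE_def, rule_format, OF e(1)] by auto
  show "\<exists>\<delta>>0. \<delta> < 1 \<and> (\<forall>y1 y2 :: 'y. norm y1 = 1 \<and> norm y2 = 1 \<and> norm (y1 + y2) / 2 > 1 - \<delta> \<longrightarrow>
        norm (y1 - y2) < \<epsilon>)"
  proof (intro exI[of _ "min \<eta> (1 / 2)"] conjI allI impI)
    show "0 < min \<eta> (1 / 2)" "min \<eta> (1 / 2) < 1" using \<eta> by auto
    fix y1 y2 :: 'y
    assume "norm y1 = 1 \<and> norm y2 = 1 \<and> norm (y1 + y2) / 2 > 1 - min \<eta> (1 / 2)"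
    then have y: "norm y1 = 1" "norm y2 = 1" "norm (y1 + y2) / 2 > 1 - \<eta>" by auto
    have um: "u1 \<in> borel_measurable M" "u2 \<in> borel_measurable M" using u1 u2 by auto
    define A where "A = {w \<in> space M. u1 w \<noteq> 0}"
    have A: "A \<in> sets M" using um(1) by (simp add: A_def)
    let ?on = "\<lambda>\<phi> w. indicator A w *\<^sub>R \<phi> w" and ?off = "\<lambda>\<phi> w. indicator (space M - A) w *\<^sub>R \<phi> w"
    note on = integrable_restrict_minus(1)[OF A] and off = integrable_restrict_minus(2)[OF A]
    define \<tau> where "\<tau> \<phi> = smul (sign_integral M u1 \<phi>) y1 + smul (sign_integral M u2 \<phi>) y2" for \<phi>
    have \<tau>_bound: "norm (\<tau> \<phi>) \<le> 1 * L1norm M \<phi>" if \<phi>: "integrable M \<phi>" for \<phi>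
    proof -
      have "sign_integral M u1 \<phi> = sign_integral M u1 (?on \<phi>)"
        by (intro sign_integral_cong) (auto simp: A_def)
      moreover have "sign_integral M u2 \<phi> = sign_integral M u2 (?off \<phi>)"
        using disjoint by (intro sign_integral_cong) (auto simp: A_def indicator_def)
      ultimately have "norm (\<tau> \<phi>) \<le> L1norm M (?on \<phi>) + L1norm M (?off \<phi>)"
        unfolding \<tau>_def
        using norm_sign_integral_le[OF um(1) on[OF \<phi>]] norm_sign_integral_le[OF um(2) off[OF \<phi>]] y
        by (intro norm_triangle_mono) (simp_all add: norm_smul)
      then show ?thesis using L1norm_split[OF A \<phi>] by simp
    qed
    have "L1_operator smul M \<tau> (norm y1 + norm y2)"
      unfolding \<tau>_def by (intro L1_operator_plus sign_operator um)
    then interpret t0: L1_operator smul M \<tau> "norm y1 + norm y2" .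
    interpret t: L1_operator smul M \<tau> 1 by (rule t0.L1_operator_rebound[OF \<tau>_bound])
    obtain T where T: "T \<in> bounded_ops X smul" "\<And>\<phi>. integrable M \<phi> \<Longrightarrow> T (cls \<phi>) = \<tau> \<phi>"
      using lift_operator[OF t.L1_operator_axioms] by blast
    have "sign_integral M u2 u1 = 0" "sign_integral M u1 u2 = 0"
      using sign_integral_cong[of M u2 u1 "\<lambda>w. 0"] sign_integral_cong[of M u1 u2 "\<lambda>w. 0"] disjoint
      by (auto simp: sign_integral_zero)
    then have \<tau>u: "\<tau> u1 = y1" "\<tau> u2 = y2"
      using u1 u2 by (simp_all add: \<tau>_def sign_integral_diag)
    have T1: "op_norm X T = 1"
    proof (rule antisym)
      show "op_norm X T \<le> 1" using \<tau>_bound T(2) by (intro op_norm_le) force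
      show "1 \<le> op_norm X T"
        using op_norm_ge[of T 1 u1] T(2) \<tau>_bound u1 \<tau>u y by simp
    qed
    define u where "u = (\<lambda>w. (1 / 2) *\<^sub>R u1 w + (1 / 2) *\<^sub>R u2 w)"
    have u: "integrable M u" using u1 u2 by (simp add: u_def)
    have u_on: "?on u w = (1 / 2) *\<^sub>R u1 w" and u_off: "?off u w = (1 / 2) *\<^sub>R u2 w"
      if "w \<in> space M" for w
      using disjoint[of w] that by (auto simp: A_def u_def indicator_def)
    have on_u: "L1norm M (?on u) = 1 / 2" "L1norm M (?off u) = 1 / 2"
    proof -
      have "L1norm M (?on u) = L1norm M (\<lambda>w. (1 / 2) *\<^sub>R u1 w)"
        by (intro Bochner_Integration.integral_cong refl) (simp only: u_on)
      then show "L1norm M (?on u) = 1 / 2" unfolding L1norm_scaleR u1(2) by simp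
      have "L1norm M (?off u) = L1norm M (\<lambda>w. (1 / 2) *\<^sub>R u2 w)"
        by (intro Bochner_Integration.integral_cong refl) (simp only: u_off)
      then show "L1norm M (?off u) = 1 / 2" unfolding L1norm_scaleR u2(2) by simp
    qed
    have "T (cls u) = (1 / 2) *\<^sub>R (y1 + y2)"
      unfolding T(2)[OF u] using u1 u2
      by (simp add: u_def t.op_add t.op_scaleR \<tau>u scaleR_right_distrib)
    then have "norm (T (cls u)) > 1 - \<eta>" using y(3) by simp
    moreover have "cls u \<in> unit_sphere X"
      using u on_u L1norm_split[OF A u] by (auto simp: unit_sphere_cls)
    ultimately obtain S x0 where S: "S \<in> RSE X smul" "op_norm X S = 1" "op_norm X (\<lambda>z. S z - T z) < e"
      and x0: "x0 \<in> unit_sphere X" "norm (S x0) = 1" "nrm X (minus_in X (cls u) x0) < e"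
      using BPB[OF T(1) T1] by blast
    obtain g where g: "x0 = cls g" "integrable M g" "L1norm M g = 1"
      using x0(1) by (auto simp: unit_sphere_cls)
    have "S \<in> bounded_ops X smul" using S(1) by (simp add: RSE_def)
    then interpret s: L1_operator smul M "\<lambda>f. S (cls f)" 1
      using bounded_op_op_norm[of S] S(2) by simp
    have ST: "norm (S (cls f) - \<tau> f) \<le> e" if f: "integrable M f" "L1norm M f \<le> 1" for f
    proof -
      have "norm (S (cls h) - T (cls h)) \<le> 2 * L1norm M h" if h: "integrable M h" for h
        using s.op_bound[OF h] t.op_bound[OF h] norm_triangle_ineq4[of "S (cls h)" "T (cls h)"]
        unfolding T(2)[OF h] by linarith
      from op_norm_ge[of "\<lambda>z. S z - T z", OF this f] show ?thesis using S(3) T(2)[OF f(1)] by simp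
    qed
    define p where "p = L1norm M (?on g)"
    define q where "q = L1norm M (?off g)"
    have pq: "p + q = 1" using L1norm_split[OF A g(2)] g(3) by (simp add: p_def q_def)
    define d1 where "d1 = L1norm M (\<lambda>w. ?on u w - ?on g w)"
    define d2 where "d2 = L1norm M (\<lambda>w. ?off u w - ?off g w)"
    have d: "d1 \<ge> 0" "d2 \<ge> 0" by (simp_all add: d1_def d2_def)
    have d12: "d1 + d2 < e"
    proof -
      have "d1 + d2 = L1norm M (\<lambda>w. u w - g w)"
        using L1norm_split[OF A, of "\<lambda>w. u w - g w"] u g by (simp add: d1_def d2_def scaleR_diff_right)
      then show ?thesis using x0(3) u g by (simp add: minus_cls nrm_cls)
    qed
    have "1 / 2 \<le> p + d1"
      using L1norm_triangle[of M "?on g" "\<lambda>w. ?on u w - ?on g w"] on[OF g(2)] on[OF u] on_u(1)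
      by (simp add: p_def d1_def)
    moreover have "1 / 2 \<le> q + d2"
      using L1norm_triangle[of M "?off g" "\<lambda>w. ?off u w - ?off g w"] off[OF g(2)] off[OF u] on_u(2)
      by (simp add: q_def d2_def)
    ultimately have pq_near: "\<bar>1 - 2 * p\<bar> \<le> 2 * e" "\<bar>1 - 2 * q\<bar> \<le> 2 * e" "p > 0" "q > 0"
      using pq d d12 e by auto
    define v1 where "v1 = (\<lambda>w. ?on g w /\<^sub>R p)"
    define v2 where "v2 = (\<lambda>w. ?off g w /\<^sub>R q)"
    have v: "integrable M v1" "integrable M v2"
      unfolding v1_def v2_def by (intro integrable_scaleR_right on off g)+
    have v_norm: "L1norm M v1 = 1" "L1norm M v2 = 1"
      unfolding v1_def v2_def L1norm_scaleR p_def[symmetric] q_def[symmetric] using pq_near by simp_all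
    have v1_near: "L1norm M (\<lambda>w. v1 w - u1 w) \<le> 4 * e"
    proof -
      have "L1norm M (\<lambda>w. v1 w - u1 w) = L1norm M (\<lambda>w. ?on g w /\<^sub>R p - 2 *\<^sub>R ?on u w)"
        by (intro Bochner_Integration.integral_cong refl) (simp add: u_on v1_def)
      also have "\<dots> \<le> \<bar>1 - 2 * p\<bar> + 2 * d1"
        unfolding p_def d1_def
        using pq_near by (intro normalized_near_half on u g) (simp add: p_def)
      finally show ?thesis using pq_near d d12 by linarith
    qed
    have v2_near: "L1norm M (\<lambda>w. v2 w - u2 w) \<le> 4 * e"
    proof -
      have "L1norm M (\<lambda>w. v2 w - u2 w) = L1norm M (\<lambda>w. ?off g w /\<^sub>R q - 2 *\<^sub>R ?off u w)"
        by (intro Bochner_Integration.integral_cong refl) (simp add: u_off v2_def)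
      also have "\<dots> \<le> \<bar>1 - 2 * q\<bar> + 2 * d2"
        unfolding q_def d2_def
        using pq_near by (intro normalized_near_half off u g) (simp add: q_def)
      finally show ?thesis using pq_near d d12 by linarith
    qed
    have near: "norm (S (cls v) - z) \<le> 5 * e"
      if "integrable M v" "integrable M h" "\<tau> h = z" "L1norm M v = 1" "L1norm M (\<lambda>w. v w - h w) \<le> 4 * e"
      for v h z
    proof -
      have "norm (\<tau> v - z) \<le> 4 * e"
        using t.op_bound[of "\<lambda>w. v w - h w"] that by (simp add: t.op_diff)
      moreover have "norm (S (cls v) - z) \<le> norm (S (cls v) - \<tau> v) + norm (\<tau> v - z)"
        using norm_triangle_ineq[of "S (cls v) - \<tau> v" "\<tau> v - z"] by simp
      ultimately show ?thesis using ST[of v] that by simp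
    qed
    have Sg: "S (cls g) = p *\<^sub>R S (cls v1) + q *\<^sub>R S (cls v2)"
    proof -
      have parts: "?on g = (\<lambda>w. p *\<^sub>R v1 w)" "?off g = (\<lambda>w. q *\<^sub>R v2 w)"
        using pq_near by (simp_all add: v1_def v2_def mult.assoc[symmetric])
      have "S (cls g) = S (cls (?on g)) + S (cls (?off g))" by (rule s.op_split[OF A g(2)])
      then show ?thesis unfolding parts using v by (simp add: s.op_scaleR)
    qed
    have "norm (S (cls v1)) \<le> 1" "norm (S (cls v2)) \<le> 1"
      using s.op_bound v v_norm by fastforce+
    moreover have "1 \<le> p * norm (S (cls v1)) + q * norm (S (cls v2))"
      using norm_triangle_ineq[of "p *\<^sub>R S (cls v1)" "q *\<^sub>R S (cls v2)"] Sg x0(2) g(1) pq_near by simp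
    moreover have "p * norm (S (cls v1)) \<le> p" "q * norm (S (cls v2)) \<le> q"
      using calculation(1,2) pq_near by simp_all
    ultimately have "p * norm (S (cls v1)) = p * 1" "q * norm (S (cls v2)) = q * 1"
      using pq by linarith+
    then have attain: "norm (S (cls v1)) = 1" "norm (S (cls v2)) = 1"
      using pq_near by simp_all
    obtain w where w: "\<And>f. integrable M f \<Longrightarrow> L1norm M f \<le> 1 \<Longrightarrow> norm (S (cls f)) = 1 \<Longrightarrow>
        \<exists>\<theta>. norm \<theta> = 1 \<and> S (cls f) = smul \<theta> w"
      using RSE_norm_attaining[OF S(1)] S(2) by metis
    obtain \<theta>1 where \<theta>1: "norm \<theta>1 = 1" "S (cls v1) = smul \<theta>1 w" using w[of v1] v v_norm attain by auto
    obtain \<theta>2 where \<theta>2: "norm \<theta>2 = 1" "S (cls v2) = smul \<theta>2 w" using w[of v2] v v_norm attain by auto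
    have w1: "norm w = 1" using \<theta>1 attain(1) by (simp add: norm_smul)
    have "S (cls g) = smul (p *\<^sub>R \<theta>1 + q *\<^sub>R \<theta>2) w"
      by (simp add: Sg \<theta>1 \<theta>2 scale_left_distrib scaleR_conv_of_real smul_of_real flip: scale_scale)
    then have "norm (p *\<^sub>R \<theta>1 + q *\<^sub>R \<theta>2) = 1" using x0(2) g(1) w1 by (simp add: norm_smul)
    then have "\<theta>1 = \<theta>2" using scalar_strictly_convex \<theta>1(1) \<theta>2(1) pq pq_near by blast
    then have same: "S (cls v1) = S (cls v2)" using \<theta>1 \<theta>2 by simp
    have "norm (S (cls v1) - y1) \<le> 5 * e"
      using v u1 \<tau>u v_norm v1_near by (intro near)
    moreover have "norm (S (cls v2) - y2) \<le> 5 * e"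
      using v u2 \<tau>u v_norm v2_near by (intro near)
    moreover have "norm (y1 - y2) \<le> norm (S (cls v1) - y1) + norm (S (cls v2) - y2)"
      using norm_triangle_ineq4[of "S (cls v2) - y2" "S (cls v1) - y1"] same by simp
    ultimately show "norm (y1 - y2) < \<epsilon>" using e by linarith
  qed
qed

end

lemma (in L1_model_banach) BPBp_RSE_iff_uniformly_convex:
  fixes u1 u2 :: "'a \<Rightarrow> 'k"
  assumes u: "integrable M u1" "integrable M u2" "\<not> (AE w in M. u1 w = 0)" "\<not> (AE w in M. u2 w = 0)"
    and disjoint: "\<And>w. u1 w = 0 \<or> u2 w = 0"
  shows "BPBp_RSE X smul \<longleftrightarrow> uniformly_convex TYPE('y)"
proof
  assume "BPBp_RSE X smul"
  then show "uniformly_convex TYPE('y)"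
  proof (rule BPBp_RSE_imp_uniformly_convex)
    let ?n = "\<lambda>u :: 'a \<Rightarrow> 'k. \<lambda>w. u w /\<^sub>R L1norm M u"
    show "integrable M (?n u1)" "integrable M (?n u2)"
      using u by (auto intro: integrable_scaleR_right)
    show "L1norm M (?n u1) = 1" "L1norm M (?n u2) = 1"
      unfolding L1norm_scaleR using L1norm_pos[OF u(1,3)] L1norm_pos[OF u(2,4)] by simp_all
    show "?n u1 w = 0 \<or> ?n u2 w = 0" for w using disjoint[of w] by auto
  qed
qed (rule uniformly_convex_imp_BPBp_RSE)

section \<open>The three domain spaces\<close>

lemma L1_model_ell1: "L1_model ell1 (count_space UNIV) (\<lambda>x :: nat \<Rightarrow> 'k::real_or_complex. x)"
  by unfold_locales
     (auto simp: ell1_def integrable_count_space_nat_iff integral_count_space_nat)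

lemma L1_model_ell1_fin:
  "L1_model (ell1_fin m) (count_space {..<m})
    (\<lambda>x :: nat \<Rightarrow> 'k::real_or_complex. \<lambda>i. if i < m then x i else 0)"
proof
  show "points (ell1_fin m) = (\<lambda>x i. if i < m then x i else 0) `
      {x :: nat \<Rightarrow> 'k. integrable (count_space {..<m}) x}"
  proof (intro equalityI subsetI)
    fix x :: "nat \<Rightarrow> 'k" assume "x \<in> points (ell1_fin m)"
    then have "x = (\<lambda>i. if i < m then x i else 0)" by (auto simp: ell1_fin_def not_less)
    moreover have "x \<in> {x. integrable (count_space {..<m}) x}" by (simp add: integrable_count_space)
    ultimately show "x \<in> (\<lambda>x i. if i < m then x i else 0) ` {x. integrable (count_space {..<m}) x}"
      by (rule image_eqI[where f="\<lambda>x i. if i < m then x i else 0"])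
  qed (auto simp: ell1_fin_def)
qed (auto simp: ell1_fin_def lebesgue_integral_count_space_finite)

lemma L1_model_L1: "L1_model (L1 M) M (L1_class M)"
proof
  show "points (L1 M) = L1_class M ` {f. integrable M f}" by (simp add: L1_def)
qed (rule add_L1_class smult_L1_class nrm_L1_class; assumption)+

text \<open>A zero-one law: if every open set contains almost all values of \<open>h\<close> on \<open>A\<close> or almost none, then
  almost all points of \<open>A\<close> have values in exactly the same members of a countable basis, and points of
  a Hausdorff space are determined by the basic open sets that contain them.\<close>

lemma AE_dichotomy_imp_AE_const:
  fixes h :: "'a \<Rightarrow> 'b::{t2_space, second_countable_topology}"
  assumes pos: "\<not> (AE w in M. w \<notin> A)"
    and dich: "\<And>U. open U \<Longrightarrow> (AE w in M. w \<in> A \<longrightarrow> h w \<in> U) \<or> (AE w in M. w \<in> A \<longrightarrow> h w \<notin> U)"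
  obtains c where "AE w in M. w \<in> A \<longrightarrow> h w = c"
proof -
  obtain \<B> :: "'b set set" where \<B>: "countable \<B>" "topological_basis \<B>"
    using ex_countable_basis by blast
  define full where "full U \<longleftrightarrow> (AE w in M. w \<in> A \<longrightarrow> h w \<in> U)" for U
  have "AE w in M. w \<in> A \<longrightarrow> (h w \<in> U \<longleftrightarrow> full U)" if "U \<in> \<B>" for U
    using dich[OF topological_basis_open[OF \<B>(2) that]] unfolding full_def
    by (cases "AE w in M. w \<in> A \<longrightarrow> h w \<in> U") auto
  then have "AE w in M. \<forall>U\<in>\<B>. w \<in> A \<longrightarrow> (h w \<in> U \<longleftrightarrow> full U)"
    by (intro AE_ball_countable' \<B>(1))
  then have ae: "AE w in M. w \<in> A \<longrightarrow> (\<forall>U\<in>\<B>. h w \<in> U \<longleftrightarrow> full U)"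
    by eventually_elim blast
  have "\<exists>w0. w0 \<in> A \<and> (\<forall>U\<in>\<B>. h w0 \<in> U \<longleftrightarrow> full U)"
  proof (rule ccontr)
    assume none: "\<not> ?thesis"
    have "AE w in M. w \<notin> A" using ae by eventually_elim (use none in blast)
    with pos show False ..
  qed
  then obtain w0 where w0: "\<And>U. U \<in> \<B> \<Longrightarrow> h w0 \<in> U \<longleftrightarrow> full U" by blast
  have eq: "h w = h w0" if w: "\<forall>U\<in>\<B>. h w \<in> U \<longleftrightarrow> full U" for w
  proof (rule ccontr)
    assume "h w \<noteq> h w0"
    then obtain V where V: "open V" "h w \<in> V" "h w0 \<notin> V"
      using t1_space by blast
    obtain U where "U \<in> \<B>" "h w \<in> U" "U \<subseteq> V"
      using topological_basisE[OF \<B>(2) V(1,2)] by blast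
    then show False using w w0 V(3) by blast
  qed
  have "AE w in M. w \<in> A \<longrightarrow> h w = h w0"
    using ae by eventually_elim (use eq in blast)
  then show ?thesis by (rule that)
qed

text \<open>For independent \<open>f\<close> and \<open>g\<close>, look at \<open>g / f\<close> on the support of \<open>f\<close>. If some open set splits its
  values in two essential parts, \<open>f\<close> splits accordingly. Otherwise the quotient is almost everywhere
  a constant \<open>c\<close>, and \<open>g - c f\<close>, which is nonzero by independence, lives off the support of \<open>f\<close>, where it
  equals \<open>g\<close>.\<close>

lemma dim_at_least_2_imp_disjoint_supports:
  assumes "dim_at_least_2 (L1 M :: ('k::real_or_complex, ('a \<Rightarrow> 'k) set) nspace)"
  obtains u1 u2 :: "'a \<Rightarrow> 'k::real_or_complex" where "integrable M u1" "integrable M u2"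
    "\<not> (AE w in M. u1 w = 0)" "\<not> (AE w in M. u2 w = 0)" "\<And>w. u1 w = 0 \<or> u2 w = 0"
proof -
  obtain f g :: "'a \<Rightarrow> 'k" where fg: "integrable M f" "integrable M g"
    and indep: "\<And>a b. add (L1 M) (smult (L1 M) a (L1_class M f)) (smult (L1 M) b (L1_class M g)) = zero (L1 M)
      \<Longrightarrow> a = 0 \<and> b = 0"
  proof -
    obtain F G :: "('a \<Rightarrow> 'k) set" where FG: "F \<in> points (L1 M)" "G \<in> points (L1 M)"
      and indep: "\<forall>a b. add (L1 M) (smult (L1 M) a F) (smult (L1 M) b G) = zero (L1 M) \<longrightarrow> a = 0 \<and> b = 0"
      using assms unfolding dim_at_least_2_def by blast
    moreover obtain f g where "integrable M f" "F = L1_class M f" "integrable M g" "G = L1_class M g"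
      using FG unfolding L1_def by auto
    ultimately show thesis using that by simp
  qed
  have indep': "a = 0 \<and> b = 0" if "AE w in M. a * f w + b * g w = 0" for a b
  proof (rule indep)
    have "add (L1 M) (smult (L1 M) a (L1_class M f)) (smult (L1 M) b (L1_class M g))
        = L1_class M (\<lambda>w. a * f w + b * g w)"
      using fg by (simp only: smult_L1_class add_L1_class integrable_mult_right)
    also have "\<dots> = L1_class M (\<lambda>w. 0)" by (rule L1_class_cong[OF that])
    also have "\<dots> = zero (L1 M)" by (simp add: L1_def)
    finally show "add (L1 M) (smult (L1 M) a (L1_class M f)) (smult (L1 M) b (L1_class M g))
        = zero (L1 M)" .
  qed
  have [measurable]: "f \<in> borel_measurable M" "g \<in> borel_measurable M" using fg by auto
  have f0: "\<not> (AE w in M. f w = 0)" using indep'[of 1 0] by auto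
  let ?A = "{w. f w \<noteq> 0}"
  show ?thesis
  proof (cases "\<exists>U. open U \<and> \<not> (AE w in M. w \<in> ?A \<longrightarrow> g w / f w \<in> U) \<and>
      \<not> (AE w in M. w \<in> ?A \<longrightarrow> g w / f w \<notin> U)")
    case True
    then obtain U where U: "open U" "\<not> (AE w in M. w \<in> ?A \<longrightarrow> g w / f w \<in> U)"
      "\<not> (AE w in M. w \<in> ?A \<longrightarrow> g w / f w \<notin> U)" by blast
    define u1 where "u1 w = (if g w / f w \<in> U then f w else 0)" for w
    define u2 where "u2 w = (if g w / f w \<in> U then 0 else f w)" for w
    have [measurable]: "U \<in> sets borel" using U(1) by simp
    have m: "u1 \<in> borel_measurable M" "u2 \<in> borel_measurable M"
      unfolding u1_def u2_def by measurable
    show ?thesis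
    proof
      show "integrable M u1" "integrable M u2"
        using m by (auto intro!: Bochner_Integration.integrable_bound[OF fg(1)] simp: u1_def u2_def)
      show "\<not> (AE w in M. u1 w = 0)"
      proof
        assume "AE w in M. u1 w = 0"
        then have "AE w in M. w \<in> ?A \<longrightarrow> g w / f w \<notin> U"
          by eventually_elim (auto simp: u1_def split: if_splits)
        then show False using U(3) by blast
      qed
      show "\<not> (AE w in M. u2 w = 0)"
      proof
        assume "AE w in M. u2 w = 0"
        then have "AE w in M. w \<in> ?A \<longrightarrow> g w / f w \<in> U"
          by eventually_elim (auto simp: u2_def split: if_splits)
        then show False using U(2) by blast
      qed
    qed (auto simp: u1_def u2_def)
  next
    case False
    have "\<not> (AE w in M. w \<notin> ?A)" using f0 by simp
    then obtain c where c: "AE w in M. w \<in> ?A \<longrightarrow> g w / f w = c"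
      by (rule AE_dichotomy_imp_AE_const[where h="\<lambda>w. g w / f w"]) (use False in blast)
    define u2 where "u2 w = (if f w = 0 then g w else 0)" for w
    have m: "u2 \<in> borel_measurable M" unfolding u2_def by measurable
    show ?thesis
    proof
      show "integrable M f" "\<not> (AE w in M. f w = 0)" by fact+
      show "integrable M u2"
        using m by (auto intro!: Bochner_Integration.integrable_bound[OF fg(2)] simp: u2_def)
      show "\<not> (AE w in M. u2 w = 0)"
      proof
        assume "AE w in M. u2 w = 0"
        with c have "AE w in M. - c * f w + 1 * g w = 0"
          by eventually_elim (auto simp: u2_def field_simps)
        then show False using indep'[of "- c" 1] by simp
      qed
    qed (auto simp: u2_def)
  qed
qed

theorem theorem3p2:
  fixes smul :: "'k::real_or_complex \<Rightarrow> 'y::banach \<Rightarrow> 'y"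
    and M :: "'a measure"
    and m :: nat
  assumes "banach_over smul"
    and dim_Y: "\<exists>B. card B = 2 \<and> \<not> module.dependent smul B"
    and "sigma_finite_measure M"
    and dim_L1: "dim_at_least_2 (L1 M :: ('k, ('a \<Rightarrow> 'k) set) nspace)"
    and "m \<ge> 2"
  shows "(BPBp_RSE (ell1_fin m) smul \<longleftrightarrow> BPBp_RSE ell1 smul) \<and>
         (BPBp_RSE ell1 smul \<longleftrightarrow> BPBp_RSE (L1 M) smul) \<and>
         (BPBp_RSE (L1 M) smul \<longleftrightarrow> uniformly_convex TYPE('y))"
proof -
  interpret Y: banach_over smul by fact
  let ?u = "\<lambda>i j :: nat. if j = i then 1 else 0 :: 'k"
  interpret fin: L1_model_banach "ell1_fin m" "count_space {..<m}"
      "\<lambda>x :: nat \<Rightarrow> 'k. \<lambda>i. if i < m then x i else 0" smul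
    by (intro L1_model_banach.intro L1_model_ell1_fin Y.banach_over_axioms)
  have "BPBp_RSE (ell1_fin m) smul \<longleftrightarrow> uniformly_convex TYPE('y)"
    using \<open>m \<ge> 2\<close>
    by (intro fin.BPBp_RSE_iff_uniformly_convex[of "?u 0" "?u 1"])
       (auto simp: integrable_count_space AE_count_space)
  moreover
  interpret inf: L1_model_banach ell1 "count_space UNIV" "\<lambda>x :: nat \<Rightarrow> 'k. x" smul
    by (intro L1_model_banach.intro L1_model_ell1 Y.banach_over_axioms)
  have summable: "summable (\<lambda>j. norm (?u i j))" for i
    by (rule summable_finite[of "{i}"]) auto
  have "BPBp_RSE ell1 smul \<longleftrightarrow> uniformly_convex TYPE('y)"
    using summable
    by (intro inf.BPBp_RSE_iff_uniformly_convex[of "?u 0" "?u 1"])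
       (auto simp: integrable_count_space_nat_iff AE_count_space)
  moreover
  interpret L1: L1_model_banach "L1 M" M "L1_class M" smul
    by (intro L1_model_banach.intro L1_model_L1 Y.banach_over_axioms)
  obtain u1 u2 :: "'a \<Rightarrow> 'k" where "integrable M u1" "integrable M u2"
    "\<not> (AE w in M. u1 w = 0)" "\<not> (AE w in M. u2 w = 0)" "\<And>w. u1 w = 0 \<or> u2 w = 0"
    using dim_at_least_2_imp_disjoint_supports[OF dim_L1] by blast
  then have "BPBp_RSE (L1 M) smul \<longleftrightarrow> uniformly_convex TYPE('y)"
    by (rule L1.BPBp_RSE_iff_uniformly_convex)
  ultimately show ?thesis by blast
qed

end
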